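(* Both \textsc{min-max} RFTT and \textsc{min-avg} RFTT (on general weighted graphs) admit polynomial-time $O(\log\tau_{\max})$-approximation algorithms, where $\tau_{\max}=\max_j\tau_j$.
   Context: RFTT: an instance is $(G,\tau)$ with $G=(V\cup\{s\},E,c)$ a connected graph with depot $s$, nonnegative edge weights $c$, clients $V=\{v_1,\dots,v_n\}$ and turnover times $\tau\in\mathbb{N}^n$. A solution gives for each day $k\ge1$ a closed walk $T_k$ in $G$ from $s$ to $s$ and a set $J_k\subseteq V$ of clients on $T_k$ visited that day; it is feasible if for all $t\ge0$ and all $j$, $v_j\in\bigcup_{k=t+1}^{t+\tau_j}J_k$; solutions are periodic with some period $\ell$. With $c(T_k)$ the total edge weight of $T_k$ with multiplicity, \textsc{min-avg} minimizes $\frac1\ell\sum_{k=1}^\ell c(T_k)$ and \textsc{min-max} minimizes $\max_k c(T_k)$. *)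

theory Defs
  imports
    Complex_Main
    "HOL-Library.Log_Nat"
    "HOL-Library.Landau_Symbols"
    "HOL-Computational_Algebra.Polynomial"
begin

section \<open>Replenishment with fixed turnover times\<close>

text \<open>
  The depot is vertex 0 and the clients are the vertices 1, ..., n.  An undirected edge is a
  two-element set of vertices.  Weights are rational, so that instances are finite objects.
\<close>

record rftt =
  clients :: nat
  edges :: "nat set set"
  weight :: "nat set \<Rightarrow> rat"
  turnover :: "nat \<Rightarrow> nat"

definition walk :: "rftt \<Rightarrow> nat \<Rightarrow> nat list \<Rightarrow> nat \<Rightarrow> bool" where
  "walk I u xs v \<longleftrightarrow> xs \<noteq> [] \<and> hd xs = u \<and> last xs = v \<and> set xs \<subseteq> {0..clients I} \<and>
     successively (\<lambda>x y. {x, y} \<in> edges I) xs"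

definition walk_cost :: "rftt \<Rightarrow> nat list \<Rightarrow> real" where
  "walk_cost I xs = (\<Sum>(x, y)\<leftarrow>zip xs (tl xs). real_of_rat (weight I {x, y}))"

definition rftt_instance :: "rftt \<Rightarrow> bool" where
  "rftt_instance I \<longleftrightarrow>
     clients I \<ge> 1 \<and>
     (\<forall>e\<in>edges I. e \<subseteq> {0..clients I} \<and> card e = 2) \<and>
     (\<forall>u\<in>{0..clients I}. \<forall>v\<in>{0..clients I}. \<exists>xs. walk I u xs v) \<and>
     (\<forall>e\<in>edges I. weight I e \<ge> 0) \<and>
     (\<forall>j\<in>{1..clients I}. turnover I j \<ge> 1)"

definition max_turnover :: "rftt \<Rightarrow> nat" where
  "max_turnover I = Max (turnover I ` {1..clients I})"

text \<open>Days are numbered from 1; the values of \<open>route\<close> and \<open>visited\<close> at 0 are irrelevant.\<close>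

record schedule =
  period :: nat
  route :: "nat \<Rightarrow> nat list"
  visited :: "nat \<Rightarrow> nat set"

definition feasible :: "rftt \<Rightarrow> schedule \<Rightarrow> bool" where
  "feasible I S \<longleftrightarrow>
     period S \<ge> 1 \<and>
     (\<forall>k\<ge>1. route S (k + period S) = route S k \<and> visited S (k + period S) = visited S k) \<and>
     (\<forall>k\<ge>1. walk I 0 (route S k) 0) \<and>
     (\<forall>k\<ge>1. visited S k \<subseteq> {1..clients I} \<inter> set (route S k)) \<and>
     (\<forall>t. \<forall>j\<in>{1..clients I}. j \<in> (\<Union>k\<in>{t + 1..t + turnover I j}. visited S k))"

definition avg_cost :: "rftt \<Rightarrow> schedule \<Rightarrow> real" where
  "avg_cost I S = (\<Sum>k = 1..period S. walk_cost I (route S k)) / real (period S)"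

text \<open>By periodicity, the maximum over one period is the maximum over all days.\<close>

definition max_cost :: "rftt \<Rightarrow> schedule \<Rightarrow> real" where
  "max_cost I S = Max ((\<lambda>k. walk_cost I (route S k)) ` {1..period S})"

text \<open>
  For both objectives and every instance, the set below is nonempty and bounded below by 0,
  so \<open>Inf\<close> is the actual infimum.
\<close>

definition opt :: "(rftt \<Rightarrow> schedule \<Rightarrow> real) \<Rightarrow> rftt \<Rightarrow> real" where
  "opt cost I = Inf {cost I S | S. feasible I S}"


section \<open>A machine model with logarithmic cost\<close>

text \<open>
  A WHILE language over binary trees whose leaves are natural numbers.  Naturals are charged by
  their binary length, and evaluating an expression is charged the total size of the values of
  all its subexpressions.  Every primitive operation is computable by a Turing machine in time
  polynomial in the sizes of its operands and result, so polynomial time in this model is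
  polynomial time on Turing machines.
\<close>

datatype data = Atom nat | Node data data

fun dsize :: "data \<Rightarrow> nat" where
  "dsize (Atom n) = 1 + floorlog 2 n"
| "dsize (Node a b) = 1 + dsize a + dsize b"

fun to_nat :: "data \<Rightarrow> nat" where
  "to_nat (Atom n) = n"
| "to_nat (Node a b) = 0"

datatype binop = Pair_op | Add_op | Sub_op | Mul_op | Div_op | Mod_op | Less_op | Eq_op

fun apply_binop :: "binop \<Rightarrow> data \<Rightarrow> data \<Rightarrow> data" where
  "apply_binop Pair_op a b = Node a b"
| "apply_binop Add_op a b = Atom (to_nat a + to_nat b)"
| "apply_binop Sub_op a b = Atom (to_nat a - to_nat b)"
| "apply_binop Mul_op a b = Atom (to_nat a * to_nat b)"
| "apply_binop Div_op a b = Atom (to_nat a div to_nat b)"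
| "apply_binop Mod_op a b = Atom (to_nat a mod to_nat b)"
| "apply_binop Less_op a b = Atom (of_bool (to_nat a < to_nat b))"
| "apply_binop Eq_op a b = Atom (of_bool (a = b))"

datatype unop = Fst_op | Snd_op | IsNode_op

fun apply_unop :: "unop \<Rightarrow> data \<Rightarrow> data" where
  "apply_unop Fst_op d = (case d of Atom _ \<Rightarrow> Atom 0 | Node a b \<Rightarrow> a)"
| "apply_unop Snd_op d = (case d of Atom _ \<Rightarrow> Atom 0 | Node a b \<Rightarrow> b)"
| "apply_unop IsNode_op d = (case d of Atom _ \<Rightarrow> Atom 0 | Node a b \<Rightarrow> Atom 1)"

datatype expr = Lit nat | Var nat | Unary unop expr | Binary binop expr expr

type_synonym store = "nat \<Rightarrow> data"

fun eval_expr :: "expr \<Rightarrow> store \<Rightarrow> data" where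
  "eval_expr (Lit n) s = Atom n"
| "eval_expr (Var x) s = s x"
| "eval_expr (Unary f e) s = apply_unop f (eval_expr e s)"
| "eval_expr (Binary f e1 e2) s = apply_binop f (eval_expr e1 s) (eval_expr e2 s)"

fun expr_time :: "expr \<Rightarrow> store \<Rightarrow> nat" where
  "expr_time (Lit n) s = dsize (Atom n)"
| "expr_time (Var x) s = dsize (s x)"
| "expr_time (Unary f e) s = expr_time e s + dsize (eval_expr (Unary f e) s)"
| "expr_time (Binary f e1 e2) s = expr_time e1 s + expr_time e2 s + dsize (eval_expr (Binary f e1 e2) s)"

datatype com =
    Skip
  | Assign nat expr
  | Seq com com
  | If expr com com
  | While expr com
  | Call nat com expr

definition init_store :: "data \<Rightarrow> store" where
  "init_store d = (\<lambda>x. Atom 0)(0 := d)"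

text \<open>
  \<open>exec c s t s'\<close>: started in \<open>s\<close>, \<open>c\<close> halts in \<open>s'\<close> after time \<open>t\<close>.  A test succeeds iff its
  value is not \<open>Atom 0\<close>.  \<open>Call x c e\<close> runs \<open>c\<close> as a non-recursive procedure on a fresh store with
  the argument in variable 0, and assigns to \<open>x\<close> the result left in variable 0.
\<close>

inductive exec :: "com \<Rightarrow> store \<Rightarrow> nat \<Rightarrow> store \<Rightarrow> bool" where
  Skip: "exec Skip s 1 s"
| Assign: "exec (Assign x e) s (1 + expr_time e s) (s(x := eval_expr e s))"
| Seq: "exec c1 s t1 s' \<Longrightarrow> exec c2 s' t2 s'' \<Longrightarrow> exec (Seq c1 c2) s (t1 + t2) s''"
| IfTrue: "eval_expr e s \<noteq> Atom 0 \<Longrightarrow> exec c1 s t s' \<Longrightarrow>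
    exec (If e c1 c2) s (1 + expr_time e s + t) s'"
| IfFalse: "eval_expr e s = Atom 0 \<Longrightarrow> exec c2 s t s' \<Longrightarrow>
    exec (If e c1 c2) s (1 + expr_time e s + t) s'"
| WhileFalse: "eval_expr e s = Atom 0 \<Longrightarrow> exec (While e c) s (1 + expr_time e s) s"
| WhileTrue: "eval_expr e s \<noteq> Atom 0 \<Longrightarrow> exec c s t1 s' \<Longrightarrow> exec (While e c) s' t2 s'' \<Longrightarrow>
    exec (While e c) s (1 + expr_time e s + t1 + t2) s''"
| Call: "exec c (init_store (eval_expr e s)) t s' \<Longrightarrow>
    exec (Call x c e) s (1 + expr_time e s + t + dsize (s' 0)) (s(x := s' 0))"

definition computes_within :: "com \<Rightarrow> data \<Rightarrow> nat \<Rightarrow> data \<Rightarrow> bool" where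
  "computes_within c d b r \<longleftrightarrow> (\<exists>t s'. exec c (init_store d) t s' \<and> t \<le> b \<and> s' 0 = r)"


section \<open>Encodings and approximation algorithms\<close>

fun enc_list :: "('a \<Rightarrow> data) \<Rightarrow> 'a list \<Rightarrow> data" where
  "enc_list f [] = Atom 0"
| "enc_list f (x # xs) = Node (f x) (enc_list f xs)"

text \<open>Used for nonnegative rationals only, written as reduced fractions.\<close>

definition enc_rat :: "rat \<Rightarrow> data" where
  "enc_rat q = (case quotient_of q of (a, b) \<Rightarrow> Node (Atom (nat a)) (Atom (nat b)))"

text \<open>
  The edges may be listed in any order and with either orientation, so an instance has several
  encodings.
\<close>

definition encodes_instance :: "data \<Rightarrow> rftt \<Rightarrow> bool" where
  "encodes_instance d I \<longleftrightarrow>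
     (\<exists>es. distinct (map (\<lambda>(u, v). {u, v}) es) \<and> (\<lambda>(u, v). {u, v}) ` set es = edges I \<and>
        d = Node (Atom (clients I))
              (Node (enc_list (\<lambda>(u, v). Node (Atom u) (Node (Atom v) (enc_rat (weight I {u, v})))) es)
                    (enc_list (\<lambda>j. Atom (turnover I j)) [1..<Suc (clients I)])))"

definition encodes_day :: "data \<Rightarrow> schedule \<Rightarrow> nat \<Rightarrow> bool" where
  "encodes_day r S k \<longleftrightarrow>
     (\<exists>js. distinct js \<and> set js = visited S k \<and>
        r = Node (Atom (period S)) (Node (enc_list Atom (route S k)) (enc_list Atom js)))"

text \<open>
  The turnover times are given in binary, so the period of a schedule, and hence an explicit list
  of its days, may be exponentially long.  An algorithm therefore produces its schedule day by
  day: on an instance and a day \<open>k\<close> it returns the period and the route and visited clients of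
  day \<open>k\<close>, in time polynomial in the binary length of the input.  The schedule is fixed
  before \<open>k\<close> is.
\<close>

definition poly_time_approximation ::
    "(rftt \<Rightarrow> schedule \<Rightarrow> real) \<Rightarrow> (rftt \<Rightarrow> real) \<Rightarrow> com \<Rightarrow> bool" where
  "poly_time_approximation cost ratio c \<longleftrightarrow>
     (\<exists>p :: nat poly. \<forall>I d. rftt_instance I \<and> encodes_instance d I \<longrightarrow>
        (\<exists>S. feasible I S \<and> cost I S \<le> ratio I * opt cost I \<and>
           (\<forall>k\<ge>1. \<exists>r. encodes_day r S k \<and>
              computes_within c (Node d (Atom k)) (poly p (dsize (Node d (Atom k)))) r)))"

end

theory Submission
  imports Defs
begin

text \<open>
  Group the clients by turnover time into the classes \<open>p \<le> \<tau> < 2 * p\<close>, \<open>p\<close> a power of two, and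
  compute with Prim's algorithm a closed walk through the depot and each class that is at most
  twice as expensive as any walk from the depot through the class.  In every feasible schedule the
  routes of \<open>2 * p\<close> consecutive days form such a walk, so the tour of class \<open>p\<close> costs at most
  \<open>4 * p\<close> times the optimum, for either objective.  For the average cost, follow the whole tour
  on every \<open>p\<close>-th day.  For the maximum cost, cut it into \<open>p\<close> segments of nearly equal cost, one
  for each residue of the day modulo \<open>p\<close>, and connect their ends to the depot; the connections are
  cheap because some optimal route goes to the client and back.  Either way a class contributes
  \<open>O(1)\<close> times the optimum, and the number of classes is the binary length of the largest turnover
  time.  Edge weights are first scaled to integers, and the days are computed independently of
  each other, since the period may be exponential.
\<close>

section \<open>Functions computable in polynomial time\<close>

text \<open>Rounding turnover times down to powers of two makes every class period divide the
  largest one, which therefore is a period of the whole schedule. The bounds p \<le> \<tau> and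
  \<tau> < 2 * p play opposite roles: the first makes one visit in every p days sufficient, the
  second forces any feasible schedule to see the whole class within 2 * p days. With Prim's factor 2
  this gives the factor 4 per class; for the maximum cost the two connections to the depot add 2
  more. On the complexity side no program for the algorithm is written out. It consists of HOL
  functions, and \<open>polytime\<close> is shown to be closed under the operations from which they
  are built. The obstacle is iteration: polynomially many polynomial-time steps may square the size
  of a value each time. So a fold requires an a priori bound on the size of its intermediate values,
  and the functions that grow walks and tours need a separate analysis of how long these
  get.\<close>

class encodable =
  fixes encode :: "'a \<Rightarrow> data"
  assumes encode_inject [simp]: "encode x = encode y \<longleftrightarrow> x = y"

instantiation nat :: encodable
begin
definition encode_nat :: "nat \<Rightarrow> data" where [simp]: "encode_nat = Atom"
instance by standard simp
end

instantiation bool :: encodable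
begin
definition encode_bool :: "bool \<Rightarrow> data" where [simp]: "encode_bool b = Atom (of_bool b)"
instance by standard (simp add: of_bool_def)
end

text \<open>Numbers, pairs and lists are encoded just as instances and days are, so that the final
  program needs no conversion of its input or output.\<close>

instantiation prod :: (encodable, encodable) encodable
begin
definition encode_prod :: "'a \<times> 'b \<Rightarrow> data" where
  [simp]: "encode_prod z = Node (encode (fst z)) (encode (snd z))"
instance by standard (simp add: prod_eq_iff)
end

lemma enc_list_inject:
  assumes "\<And>x y. f x = f y \<longleftrightarrow> x = y"
  shows "enc_list f xs = enc_list f ys \<longleftrightarrow> xs = ys"
proof (induction xs arbitrary: ys)
  case Nil
  then show ?case by (cases ys) auto
next
  case (Cons x xs)
  then show ?case using assms by (cases ys) auto
qed

instantiation list :: (encodable) encodable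
begin
definition encode_list :: "'a list \<Rightarrow> data" where [simp]: "encode_list = enc_list encode"
instance by standard (simp add: enc_list_inject)
end

abbreviation esize :: "'a::encodable \<Rightarrow> nat" where
  "esize x \<equiv> dsize (encode x)"

lemma esize_bool: "esize (b :: bool) \<le> 2"
  by (simp add: floorlog_def)

section \<open>Polynomial bounds in the size of the encoded input\<close>

lemma dsize_pos: "dsize d \<ge> 1"
  by (cases d) auto

lemma poly_nat_mono:
  fixes p :: "nat poly"
  shows "x \<le> y \<Longrightarrow> poly p x \<le> poly p y"
  by (induction p) (auto intro!: add_mono mult_mono)

text \<open>The bounded quantity is a function of the value, not of its size: running times, numbers
  of rounds and sizes of intermediate values all have this form.\<close>

definition pbound :: "('a::encodable \<Rightarrow> nat) \<Rightarrow> bool" where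
  "pbound g \<longleftrightarrow> (\<exists>p :: nat poly. \<forall>x. g x \<le> poly p (esize x))"

lemma pbound_le: "pbound g \<Longrightarrow> (\<And>x. f x \<le> g x) \<Longrightarrow> pbound f"
  unfolding pbound_def using order_trans by meson

lemma pbound_const: "pbound (\<lambda>x. k)"
  unfolding pbound_def by (rule exI[of _ "[:k:]"]) auto

lemma pbound_esize: "pbound (\<lambda>x. esize x)"
  unfolding pbound_def by (rule exI[of _ "[:0, 1:]"]) auto

lemma pbound_add: "pbound f \<Longrightarrow> pbound g \<Longrightarrow> pbound (\<lambda>x. f x + g x)"
  unfolding pbound_def
proof (elim exE)
  fix p q :: "nat poly"
  assume "\<forall>x. f x \<le> poly p (esize x)" "\<forall>x. g x \<le> poly q (esize x)"
  then show "\<exists>r. \<forall>x. f x + g x \<le> poly r (esize x)"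
    by (intro exI[of _ "p + q"]) (auto intro: add_mono)
qed

lemma pbound_mult: "pbound f \<Longrightarrow> pbound g \<Longrightarrow> pbound (\<lambda>x. f x * g x)"
  unfolding pbound_def
proof (elim exE)
  fix p q :: "nat poly"
  assume "\<forall>x. f x \<le> poly p (esize x)" "\<forall>x. g x \<le> poly q (esize x)"
  then show "\<exists>r. \<forall>x. f x * g x \<le> poly r (esize x)"
    by (intro exI[of _ "p * q"]) (auto intro: mult_mono)
qed

lemma pbound_poly: "pbound f \<Longrightarrow> pbound (\<lambda>x. poly p (f x))"
  unfolding pbound_def
proof (elim exE)
  fix q :: "nat poly"
  assume "\<forall>x. f x \<le> poly q (esize x)"
  then show "\<exists>r. \<forall>x. poly p (f x) \<le> poly r (esize x)"
    by (intro exI[of _ "pcompose p q"]) (auto simp: poly_pcompose intro: poly_nat_mono)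
qed

lemma pbound_comp:
  assumes "pbound T" "pbound (\<lambda>x. esize (f x))"
  shows "pbound (\<lambda>x. T (f x))"
proof -
  from assms(1) obtain p where p: "\<And>x. T x \<le> poly p (esize x)"
    unfolding pbound_def by blast
  show ?thesis
    by (rule pbound_le[OF pbound_poly[OF assms(2), of p]]) (rule p)
qed

text \<open>The budget \<open>b\<close> also covers the size of the result, so that a time bound for a function is at
  the same time a size bound for its values.\<close>

definition runs :: "com \<Rightarrow> data \<Rightarrow> nat \<Rightarrow> data \<Rightarrow> bool" where
  "runs c d b r \<longleftrightarrow> (\<exists>t s'. exec c (init_store d) t s' \<and> t + dsize r \<le> b \<and> s' 0 = r)"

text \<open>The requirement covers every value of the type, including lists that come from no
  instance. Size bounds for the graph algorithms can therefore not rely on properties of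
  instances.\<close>

definition polytime :: "('a::encodable \<Rightarrow> 'b::encodable) \<Rightarrow> bool" where
  "polytime f \<longleftrightarrow> (\<exists>c T. pbound T \<and> (\<forall>x. runs c (encode x) (T x) (encode (f x))))"

lemma polytime_esize: "polytime f \<Longrightarrow> pbound (\<lambda>x. esize (f x))"
  unfolding polytime_def runs_def by (meson add_leD2 pbound_le)

section \<open>Composition, constants, pairing and branching\<close>

lemma init_store_0 [simp]: "init_store d 0 = d"
  by (simp add: init_store_def)

lemma dsize_eval_expr: "dsize (eval_expr e s) \<le> expr_time e s"
  by (cases e) auto

lemma polytime_expr:
  fixes f :: "'a::encodable \<Rightarrow> 'b::encodable"
  assumes "\<And>x. eval_expr e (init_store (encode x)) = encode (f x)"
    and "pbound (\<lambda>x::'a. expr_time e (init_store (encode x)))"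
  shows "polytime f"
  unfolding polytime_def
proof (intro exI conjI allI)
  \<comment> \<open>The second evaluation time pays for the result, whose size it bounds.\<close>
  show "pbound (\<lambda>x::'a. 1 + expr_time e (init_store (encode x)) + expr_time e (init_store (encode x)))"
    using assms(2) by (intro pbound_add pbound_const)
next
  fix x :: 'a
  show "runs (Assign 0 e) (encode x)
     (1 + expr_time e (init_store (encode x)) + expr_time e (init_store (encode x))) (encode (f x))"
    unfolding runs_def
    by (intro exI conjI, rule exec.Assign)
       (use dsize_eval_expr[of e "init_store (encode x)"] assms(1)[of x] in auto)
qed

named_theorems polytime_intro

text \<open>\<open>Call\<close> runs each program on a fresh store, so programs are combined without
  renaming variables. The time of the second one is polynomial because the budget of the first also
  bounds the size of the intermediate value.\<close>

lemma polytime_comp: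
  assumes "polytime g" "polytime f"
  shows "polytime (\<lambda>x. g (f x))"
proof -
  obtain cf Tf where f: "pbound Tf" "\<And>x. runs cf (encode x) (Tf x) (encode (f x))"
    using assms(2) unfolding polytime_def by blast
  obtain cg Tg where g: "pbound Tg" "\<And>x. runs cg (encode x) (Tg x) (encode (g x))"
    using assms(1) unfolding polytime_def by blast
  define c where "c = Seq (Call 0 cf (Var 0)) (Call 0 cg (Var 0))"
  define T where "T x = 2 + esize x + Tf x + esize (f x) + Tg (f x) + esize (g (f x))" for x
  have pb: "pbound (\<lambda>x. Tg (f x))" "pbound (\<lambda>x. esize (g (f x)))"
    using pbound_comp[OF g(1) polytime_esize[OF assms(2)]]
      pbound_comp[OF polytime_esize[OF assms(1)] polytime_esize[OF assms(2)]] by auto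
  have "pbound T"
    unfolding T_def by (intro pbound_add pbound_const pbound_esize f(1) pb polytime_esize[OF assms(2)])
  moreover have "runs c (encode x) (T x) (encode (g (f x)))" for x
  proof -
    obtain t1 s1 where 1: "exec cf (init_store (encode x)) t1 s1"
      "t1 + esize (f x) \<le> Tf x" "s1 0 = encode (f x)"
      using f(2)[of x] unfolding runs_def by blast
    obtain t2 s2 where 2: "exec cg (init_store (encode (f x))) t2 s2"
      "t2 + esize (g (f x)) \<le> Tg (f x)" "s2 0 = encode (g (f x))"
      using g(2)[of "f x"] unfolding runs_def by blast
    let ?s = "init_store (encode x)"
    let ?s' = "?s(0 := s1 0)"
    have e1: "exec (Call 0 cf (Var 0)) ?s (1 + esize x + t1 + esize (f x)) ?s'"
      using exec.Call[of cf "Var 0" ?s t1 s1 0] 1 by simp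
    have e2: "exec (Call 0 cg (Var 0)) ?s' (1 + esize (f x) + t2 + esize (g (f x))) (?s'(0 := s2 0))"
      using exec.Call[of cg "Var 0" ?s' t2 s2 0] 1 2 by simp
    show ?thesis
      unfolding runs_def c_def
      by (rule exI, rule exI, rule conjI, rule exec.Seq[OF e1 e2])
         (use 1 2 in \<open>auto simp: T_def\<close>)
  qed
  ultimately show ?thesis unfolding polytime_def by blast
qed

lemma polytime_id [polytime_intro]: "polytime (\<lambda>x. x)"
  by (rule polytime_expr[of "Var 0"]) (auto intro: pbound_esize)

fun lit :: "data \<Rightarrow> expr" where
  "lit (Atom n) = Lit n"
| "lit (Node a b) = Binary Pair_op (lit a) (lit b)"

lemma eval_lit [simp]: "eval_expr (lit d) s = d"
  by (induction d) auto

lemma time_lit: "expr_time (lit d) s = expr_time (lit d) t"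
  by (induction d) auto

lemma polytime_const [polytime_intro]: "polytime (\<lambda>x. k)"
proof (rule polytime_expr[of "lit (encode k)"])
  show "pbound (\<lambda>x. expr_time (lit (encode k)) (init_store (encode x)))"
    by (subst time_lit[of _ _ "\<lambda>_. Atom 0"]) (rule pbound_const)
qed simp

lemma polytime_pair [polytime_intro]:
  assumes "polytime f" "polytime g"
  shows "polytime (\<lambda>x. (f x, g x))"
proof -
  obtain cf Tf where f: "pbound Tf" "\<And>x. runs cf (encode x) (Tf x) (encode (f x))"
    using assms(1) unfolding polytime_def by blast
  obtain cg Tg where g: "pbound Tg" "\<And>x. runs cg (encode x) (Tg x) (encode (g x))"
    using assms(2) unfolding polytime_def by blast
  define c where "c = Seq (Call 1 cf (Var 0)) (Seq (Call 2 cg (Var 0))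
    (Assign 0 (Binary Pair_op (Var 1) (Var 2))))"
  define T where "T x = 5 + 2 * esize x + Tf x + Tg x + 4 * esize (f x) + 4 * esize (g x)" for x
  have "pbound T"
    unfolding T_def
    by (intro pbound_add pbound_mult pbound_const pbound_esize f(1) g(1)
        polytime_esize[OF assms(1)] polytime_esize[OF assms(2)])
  moreover have "runs c (encode x) (T x) (encode (f x, g x))" for x
  proof -
    obtain t1 s1 where 1: "exec cf (init_store (encode x)) t1 s1"
      "t1 + esize (f x) \<le> Tf x" "s1 0 = encode (f x)"
      using f(2)[of x] unfolding runs_def by blast
    obtain t2 s2 where 2: "exec cg (init_store (encode x)) t2 s2"
      "t2 + esize (g x) \<le> Tg x" "s2 0 = encode (g x)"
      using g(2)[of x] unfolding runs_def by blast
    let ?s = "init_store (encode x)"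
    let ?s' = "?s(1 := s1 0)"
    have e1: "exec (Call 1 cf (Var 0)) ?s (1 + esize x + t1 + esize (f x)) ?s'"
      using exec.Call[of cf "Var 0" ?s t1 s1 1] 1 by simp
    have e2: "exec (Call 2 cg (Var 0)) ?s' (1 + esize x + t2 + esize (g x)) (?s'(2 := s2 0))"
      using exec.Call[of cg "Var 0" ?s' t2 s2 2] 2 by simp
    show ?thesis
      unfolding runs_def c_def
      by (rule exI, rule exI, rule conjI, rule exec.Seq[OF e1 exec.Seq[OF e2 exec.Assign]])
         (use 1 2 in \<open>auto simp: T_def\<close>)
  qed
  ultimately show ?thesis unfolding polytime_def by blast
qed

text \<open>Gives functions of several arguments their introduction rules: only the uncurried form,
  applied to projections, has to be treated.\<close>

lemma polytime_comp2:
  assumes "polytime (\<lambda>z. h (fst z) (snd z))" "polytime f" "polytime g"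
  shows "polytime (\<lambda>x. h (f x) (g x))"
  using polytime_comp[OF assms(1) polytime_pair[OF assms(2,3)]] by simp

lemma polytime_comp3:
  assumes "polytime (\<lambda>z. h (fst z) (fst (snd z)) (snd (snd z)))" "polytime f" "polytime g" "polytime k"
  shows "polytime (\<lambda>x. h (f x) (g x) (k x))"
  using polytime_comp[OF assms(1) polytime_pair[OF assms(2) polytime_pair[OF assms(3,4)]]] by simp

lemma polytime_if [polytime_intro]:
  assumes "polytime b" "polytime f" "polytime g"
  shows "polytime (\<lambda>x. if b x then f x else g x)"
proof -
  obtain cb Tb where b: "pbound Tb" "\<And>x. runs cb (encode x) (Tb x) (encode (b x))"
    using assms(1) unfolding polytime_def by blast
  obtain cf Tf where f: "pbound Tf" "\<And>x. runs cf (encode x) (Tf x) (encode (f x))"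
    using assms(2) unfolding polytime_def by blast
  obtain cg Tg where g: "pbound Tg" "\<And>x. runs cg (encode x) (Tg x) (encode (g x))"
    using assms(3) unfolding polytime_def by blast
  define c where "c = Seq (Call 1 cb (Var 0)) (If (Var 1) (Call 0 cf (Var 0)) (Call 0 cg (Var 0)))"
  define T where "T x = 5 + 2 * esize x + Tb x + Tf x + Tg x + esize (b x) + esize (f x) + esize (g x)" for x
  have "pbound T"
    unfolding T_def
    by (intro pbound_add pbound_mult pbound_const pbound_esize f(1) g(1) b(1)
        polytime_esize[OF assms(1)] polytime_esize[OF assms(2)] polytime_esize[OF assms(3)])
  moreover have "runs c (encode x) (T x) (encode (if b x then f x else g x))" for x
  proof -
    let ?s = "init_store (encode x)"
    obtain t0 s0 where 0: "exec cb ?s t0 s0"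
      "t0 + esize (b x) \<le> Tb x" "s0 0 = encode (b x)"
      using b(2)[of x] unfolding runs_def by blast
    let ?s' = "?s(1 := s0 0)"
    have e0: "exec (Call 1 cb (Var 0)) ?s (1 + esize x + t0 + esize (b x)) ?s'"
      using exec.Call[of cb "Var 0" ?s t0 s0 1] 0 by simp
    show ?thesis
    proof (cases "b x")
      case True
      obtain t1 s1 where 1: "exec cf ?s t1 s1"
        "t1 + esize (f x) \<le> Tf x" "s1 0 = encode (f x)"
        using f(2)[of x] unfolding runs_def by blast
      have e1: "exec (Call 0 cf (Var 0)) ?s' (1 + esize x + t1 + esize (f x)) (?s'(0 := s1 0))"
        using exec.Call[of cf "Var 0" ?s' t1 s1 0] 1 by simp
      have ne: "eval_expr (Var 1) ?s' \<noteq> Atom 0" using 0 True by simp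
      show ?thesis
        unfolding runs_def c_def
        by (rule exI, rule exI, rule conjI, rule exec.Seq[OF e0 exec.IfTrue[OF ne e1]])
           (use 0 1 True in \<open>auto simp: T_def\<close>)
    next
      case False
      obtain t1 s1 where 1: "exec cg ?s t1 s1"
        "t1 + esize (g x) \<le> Tg x" "s1 0 = encode (g x)"
        using g(2)[of x] unfolding runs_def by blast
      have e1: "exec (Call 0 cg (Var 0)) ?s' (1 + esize x + t1 + esize (g x)) (?s'(0 := s1 0))"
        using exec.Call[of cg "Var 0" ?s' t1 s1 0] 1 by simp
      have ne: "eval_expr (Var 1) ?s' = Atom 0" using 0 False by simp
      show ?thesis
        unfolding runs_def c_def
        by (rule exI, rule exI, rule conjI, rule exec.Seq[OF e0 exec.IfFalse[OF ne e1]])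
           (use 0 1 False in \<open>auto simp: T_def\<close>)
    qed
  qed
  ultimately show ?thesis unfolding polytime_def by blast
qed

text \<open>Loop tests are expressions, so the truth value of \<open>b\<close> is computed by a
  procedure and kept in variable 1 for the next test; variable 0 holds the iterate.\<close>

lemma exec_while_funpow:
  fixes b :: "'a::encodable \<Rightarrow> bool"
  assumes b: "\<And>x. runs cb (encode x) (poly pb (esize x)) (encode (b x))"
    and g: "\<And>x. runs cg (encode x) (poly pg (esize x)) (encode (g x))"
    and "\<And>i. i < k \<Longrightarrow> b ((g ^^ i) x)" "\<not> b ((g ^^ k) x)"
    and "\<And>i. i \<le> k \<Longrightarrow> esize ((g ^^ i) x) \<le> B"
    and "s 0 = encode x" "s 1 = encode (b x)"
  shows "\<exists>t s'. exec (While (Var 1) (Seq (Call 0 cg (Var 0)) (Call 1 cb (Var 0)))) s t s' \<and>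
    s' 0 = encode ((g ^^ k) x) \<and> t \<le> Suc k * (10 + 3 * B + poly pg B + poly pb B)"
  using assms(3-)
proof (induction k arbitrary: x s)
  case 0
  then have "eval_expr (Var 1) s = Atom 0" by simp
  from exec.WhileFalse[OF this] show ?case
    by (intro exI conjI, assumption) (use 0 esize_bool[of "b x"] in auto)
next
  case (Suc k)
  have bx: "b x" using Suc.prems(1)[of 0] by simp
  obtain t1 s1 where 1: "exec cg (init_store (encode x)) t1 s1"
    "t1 + esize (g x) \<le> poly pg (esize x)" "s1 0 = encode (g x)"
    using g[of x] unfolding runs_def by blast
  obtain t2 s2 where 2: "exec cb (init_store (encode (g x))) t2 s2"
    "t2 + esize (b (g x)) \<le> poly pb (esize (g x))" "s2 0 = encode (b (g x))"
    using b[of "g x"] unfolding runs_def by blast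
  let ?s = "s(0 := s1 0, 1 := s2 0)"
  have e1: "exec (Call 0 cg (Var 0)) s (1 + esize x + t1 + esize (g x)) (s(0 := s1 0))"
    using exec.Call[of cg "Var 0" s t1 s1 0] 1 Suc.prems by simp
  have e2: "exec (Call 1 cb (Var 0)) (s(0 := s1 0)) (1 + esize (g x) + t2 + esize (b (g x))) ?s"
    using exec.Call[of cb "Var 0" "s(0 := s1 0)" t2 s2 1] 1 2 by simp
  have sh: "(g ^^ i) (g x) = (g ^^ Suc i) x" for i
    by (simp add: funpow_swap1)
  have "\<exists>t s'. exec (While (Var 1) (Seq (Call 0 cg (Var 0)) (Call 1 cb (Var 0)))) ?s t s' \<and>
    s' 0 = encode ((g ^^ k) (g x)) \<and> t \<le> Suc k * (10 + 3 * B + poly pg B + poly pb B)"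
  proof (rule Suc.IH)
    fix i assume "i < k" then show "b ((g ^^ i) (g x))" using Suc.prems(1)[of "Suc i"] sh by simp
  next
    show "\<not> b ((g ^^ k) (g x))" using Suc.prems(2) sh by simp
  next
    fix i assume "i \<le> k" then show "esize ((g ^^ i) (g x)) \<le> B" using Suc.prems(3)[of "Suc i"] sh by simp
  qed (use 1 2 in auto)
  then obtain t s' where 3: "exec (While (Var 1) (Seq (Call 0 cg (Var 0)) (Call 1 cb (Var 0)))) ?s t s'"
    "s' 0 = encode ((g ^^ k) (g x))" "t \<le> Suc k * (10 + 3 * B + poly pg B + poly pb B)"
    by blast
  have ne: "eval_expr (Var 1) s \<noteq> Atom 0" using bx Suc.prems(5) by simp
  have sz: "esize x \<le> B" "esize (g x) \<le> B"
    using Suc.prems(3)[of 0] Suc.prems(3)[of 1] by auto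
  have "poly pg (esize x) \<le> poly pg B" "poly pb (esize (g x)) \<le> poly pb B"
    using sz poly_nat_mono by blast+
  moreover note esize_bool[of "b (g x)"]
  moreover have "esize x = dsize (s 0)" "esize (b x) = dsize (s 1)"
    using Suc.prems by simp_all
  moreover note esize_bool[of "b x"]
  ultimately have tt: "1 + expr_time (Var 1) s + ((1 + esize x + t1 + esize (g x)) + (1 + esize (g x) + t2 + esize (b (g x)))) + t
    \<le> Suc (Suc k) * (10 + 3 * B + poly pg B + poly pb B)"
    using 1(2) 2(2) sz 3(3) by (simp del: encode_bool_def)
  show ?case
    by (rule exI, rule exI, rule conjI, rule exec.WhileTrue[OF ne exec.Seq[OF e1 e2] 3(1)])
       (use 3(2) sh tt in \<open>auto\<close>)
qed

text \<open>Since \<open>B\<close> bounds all iterates, each round costs at most a polynomial in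
  \<open>B x\<close>. \<open>N x\<close> is the exact number of rounds: the test holds before each
  of them and fails afterwards.\<close>

lemma polytime_while:
  fixes g :: "'a::encodable \<Rightarrow> 'a" and a :: "'b::encodable \<Rightarrow> 'a"
  assumes b: "polytime b" and g: "polytime g" and a: "polytime a" and N: "pbound N" and B: "pbound B"
    and "\<And>x i. i < N x \<Longrightarrow> b ((g ^^ i) (a x))" "\<And>x. \<not> b ((g ^^ N x) (a x))"
    and "\<And>x i. i \<le> N x \<Longrightarrow> esize ((g ^^ i) (a x)) \<le> B x"
  shows "polytime (\<lambda>x. (g ^^ N x) (a x))"
proof -
  obtain cb Tb where b': "pbound Tb" "\<And>x. runs cb (encode x) (Tb x) (encode (b x))"
    using b unfolding polytime_def by blast
  obtain cg Tg where g': "pbound Tg" "\<And>x. runs cg (encode x) (Tg x) (encode (g x))"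
    using g unfolding polytime_def by blast
  obtain ca Ta where a': "pbound Ta" "\<And>x. runs ca (encode x) (Ta x) (encode (a x))"
    using a unfolding polytime_def by blast
  obtain pb where pb: "\<And>x. Tb x \<le> poly pb (esize x)" using b'(1) unfolding pbound_def by blast
  obtain pg where pg: "\<And>x. Tg x \<le> poly pg (esize x)" using g'(1) unfolding pbound_def by blast
  have rb: "runs cb (encode x) (poly pb (esize x)) (encode (b x))" for x
    using b'(2)[of x] pb[of x] unfolding runs_def by (meson order_trans)
  have rg: "runs cg (encode x) (poly pg (esize x)) (encode (g x))" for x
    using g'(2)[of x] pg[of x] unfolding runs_def by (meson order_trans)
  define loop where "loop = While (Var 1) (Seq (Call 0 cg (Var 0)) (Call 1 cb (Var 0)))"
  define c where "c = Seq (Call 0 ca (Var 0)) (Seq (Call 1 cb (Var 0)) loop)"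
  define T where "T x = 5 + esize x + Ta x + esize (a x) + poly pb (esize (a x)) +
    Suc (N x) * (10 + 3 * B x + poly pg (B x) + poly pb (B x)) + B x" for x
  have "pbound T"
    unfolding T_def Suc_eq_plus1
    by (intro pbound_add pbound_mult pbound_const pbound_esize pbound_poly N B a'(1) polytime_esize[OF a])
  moreover have "runs c (encode x) (T x) (encode ((g ^^ N x) (a x)))" for x
  proof -
    let ?s = "init_store (encode x)"
    obtain t1 s1 where 1: "exec ca ?s t1 s1" "t1 + esize (a x) \<le> Ta x" "s1 0 = encode (a x)"
      using a'(2)[of x] unfolding runs_def by blast
    obtain t0 s0 where 0: "exec cb (init_store (encode (a x))) t0 s0"
      "t0 + esize (b (a x)) \<le> poly pb (esize (a x))" "s0 0 = encode (b (a x))"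
      using rb[of "a x"] unfolding runs_def by blast
    let ?s1 = "?s(0 := s1 0)"
    let ?s' = "?s1(1 := s0 0)"
    have e1: "exec (Call 0 ca (Var 0)) ?s (1 + esize x + t1 + esize (a x)) ?s1"
      using exec.Call[of ca "Var 0" ?s t1 s1 0] 1 by simp
    have e0: "exec (Call 1 cb (Var 0)) ?s1 (1 + esize (a x) + t0 + esize (b (a x))) ?s'"
      using exec.Call[of cb "Var 0" ?s1 t0 s0 1] 0 1 by simp
    have "\<exists>t s'. exec loop ?s' t s' \<and> s' 0 = encode ((g ^^ N x) (a x)) \<and>
        t \<le> Suc (N x) * (10 + 3 * B x + poly pg (B x) + poly pb (B x))"
      unfolding loop_def by (rule exec_while_funpow[OF rb rg]) (use assms(6-8) 0 1 in auto)
    then obtain t s' where 2: "exec loop ?s' t s'" "s' 0 = encode ((g ^^ N x) (a x))"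
      "t \<le> Suc (N x) * (10 + 3 * B x + poly pg (B x) + poly pb (B x))"
      by blast
    have 3: "esize (b (a x)) \<le> 2" by (rule esize_bool)
    have 4: "esize ((g ^^ N x) (a x)) \<le> B x" using assms(8) by blast
    show ?thesis
      unfolding runs_def c_def
      by (intro exI conjI, rule exec.Seq[OF e1 exec.Seq[OF e0 2(1)]])
         (use 0 1 2 3 4 in \<open>auto simp: T_def simp del: encode_bool_def\<close>)
  qed
  ultimately show ?thesis unfolding polytime_def by blast
qed

section \<open>Arithmetic, comparisons and truth values\<close>

lemma floorlog_add_le: "floorlog 2 (m + n) \<le> Suc (floorlog 2 m + floorlog 2 n)"
proof -
  have "m < 2 ^ floorlog 2 m" "n < 2 ^ floorlog 2 n"
    using floorlog_leD[of 2 _ "floorlog 2 _"] by auto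
  moreover have "(2::nat) ^ floorlog 2 m \<le> 2 ^ (floorlog 2 m + floorlog 2 n)"
    "(2::nat) ^ floorlog 2 n \<le> 2 ^ (floorlog 2 m + floorlog 2 n)"
    by (intro power_increasing; simp)+
  ultimately have "m + n < 2 ^ Suc (floorlog 2 m + floorlog 2 n)"
    unfolding power_Suc by linarith
  then show ?thesis by (intro floorlog_leI) auto
qed

lemma floorlog_mult_le: "floorlog 2 (m * n) \<le> floorlog 2 m + floorlog 2 n"
proof -
  have "m < 2 ^ floorlog 2 m" "n < 2 ^ floorlog 2 n"
    using floorlog_leD[of 2 _ "floorlog 2 _"] by auto
  then have "m * n < 2 ^ (floorlog 2 m + floorlog 2 n)"
    unfolding power_add by (intro mult_strict_mono) auto
  then show ?thesis by (intro floorlog_leI) auto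
qed

lemma esize_add: "esize (m + n :: nat) \<le> esize m + esize n"
  using floorlog_add_le[of m n] by simp

lemma esize_mult: "esize (m * n :: nat) \<le> esize m + esize n"
  using floorlog_mult_le[of m n] by simp

lemma esize_le_Suc: "esize (n :: nat) \<le> Suc n"
proof -
  have "n < 2 ^ n" by (rule less_exp)
  then have "floorlog 2 n \<le> n" by (intro floorlog_leI) auto
  then show ?thesis by simp
qed

lemma polytime_fst [polytime_intro]:
  assumes "polytime f" shows "polytime (\<lambda>x. fst (f x))"
proof (rule polytime_comp[OF _ assms])
  show "polytime (\<lambda>z::'b \<times> 'c. fst z)"
  proof (rule polytime_expr[of "Unary Fst_op (Var 0)"])
    show "pbound (\<lambda>z::'b \<times> 'c. expr_time (Unary Fst_op (Var 0)) (init_store (encode z)))"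
      by (rule pbound_le[OF pbound_mult[OF pbound_const[of 2] pbound_esize]]) simp
  qed simp
qed

lemma polytime_snd [polytime_intro]:
  assumes "polytime f" shows "polytime (\<lambda>x. snd (f x))"
proof (rule polytime_comp[OF _ assms])
  show "polytime (\<lambda>z::'b \<times> 'c. snd z)"
  proof (rule polytime_expr[of "Unary Snd_op (Var 0)"])
    show "pbound (\<lambda>z::'b \<times> 'c. expr_time (Unary Snd_op (Var 0)) (init_store (encode z)))"
      by (rule pbound_le[OF pbound_mult[OF pbound_const[of 2] pbound_esize]]) simp
  qed simp
qed

text \<open>The margin of 2 in the size condition accommodates a truth value or the node of a
  pair.\<close>

lemma polytime_binop:
  fixes h :: "'a::encodable \<Rightarrow> 'b::encodable \<Rightarrow> 'c::encodable"
  assumes "\<And>x y. apply_binop op (encode x) (encode y) = encode (h x y)"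
    and size: "\<And>x y. esize (h x y) \<le> esize x + esize y + 2"
    and "polytime f" "polytime g"
  shows "polytime (\<lambda>x. h (f x) (g x))"
proof (rule polytime_comp2[OF _ assms(3,4)])
  let ?e = "Binary op (Unary Fst_op (Var 0)) (Unary Snd_op (Var 0))"
  show "polytime (\<lambda>z::'a \<times> 'b. h (fst z) (snd z))"
  proof (rule polytime_expr[of ?e])
    show "pbound (\<lambda>z::'a \<times> 'b. expr_time ?e (init_store (encode z)))"
    proof (rule pbound_le[OF pbound_add[OF pbound_const[of 2] pbound_mult[OF pbound_const[of 4] pbound_esize]]])
      fix z :: "'a \<times> 'b"
      show "expr_time ?e (init_store (encode z)) \<le> 2 + 4 * esize z"
        using size[of "fst z" "snd z"] by (simp add: assms(1))
    qed
  qed (simp add: assms(1))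
qed

lemma polytime_add [polytime_intro]:
  "polytime f \<Longrightarrow> polytime g \<Longrightarrow> polytime (\<lambda>x. f x + g x :: nat)"
  by (rule polytime_binop[of Add_op "(+)"]) (simp, rule trans_le_add1[OF esize_add])

lemma polytime_mult [polytime_intro]:
  "polytime f \<Longrightarrow> polytime g \<Longrightarrow> polytime (\<lambda>x. f x * g x :: nat)"
  by (rule polytime_binop[of Mul_op "(*)"]) (simp, rule trans_le_add1[OF esize_mult])

lemma polytime_div [polytime_intro]:
  "polytime f \<Longrightarrow> polytime g \<Longrightarrow> polytime (\<lambda>x. f x div g x :: nat)"
  by (rule polytime_binop[of Div_op "(div)"])
     (auto intro!: le_SucI trans_le_add1 floorlog_mono)

lemma polytime_mod [polytime_intro]:
  "polytime f \<Longrightarrow> polytime g \<Longrightarrow> polytime (\<lambda>x. f x mod g x :: nat)"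
  by (rule polytime_binop[of Mod_op "(mod)"])
     (auto intro!: le_SucI trans_le_add1 floorlog_mono)

lemma polytime_less [polytime_intro]:
  "polytime f \<Longrightarrow> polytime g \<Longrightarrow> polytime (\<lambda>x. (f x :: nat) < g x)"
  by (rule polytime_binop[of Less_op "(<)"]) (auto simp: floorlog_def)

text \<open>\<open>Eq_op\<close> compares trees; injectivity of \<open>encode\<close> turns this
  into a comparison of values, at every type.\<close>

lemma polytime_eq [polytime_intro]:
  "polytime f \<Longrightarrow> polytime g \<Longrightarrow> polytime (\<lambda>x. f x = g x)"
  by (rule polytime_binop[of Eq_op "(=)"])
     (auto simp: floorlog_def intro!: trans_le_add2)

lemma polytime_cong: "(\<And>x. f x = g x) \<Longrightarrow> polytime g \<Longrightarrow> polytime f"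
  by (metis ext)

lemma polytime_not [polytime_intro]: "polytime f \<Longrightarrow> polytime (\<lambda>x. \<not> f x)"
  by (rule polytime_cong[of _ "\<lambda>x. if f x then False else True"]) (simp, intro polytime_intro)

lemma polytime_conj [polytime_intro]:
  "polytime f \<Longrightarrow> polytime g \<Longrightarrow> polytime (\<lambda>x. f x \<and> g x)"
  by (rule polytime_cong[of _ "\<lambda>x. if f x then g x else False"]) (simp, intro polytime_intro)

lemma polytime_disj [polytime_intro]:
  "polytime f \<Longrightarrow> polytime g \<Longrightarrow> polytime (\<lambda>x. f x \<or> g x)"
  by (rule polytime_cong[of _ "\<lambda>x. if f x then True else g x"]) (simp, intro polytime_intro)

lemma polytime_le [polytime_intro]:
  "polytime f \<Longrightarrow> polytime g \<Longrightarrow> polytime (\<lambda>x. (f x :: nat) \<le> g x)"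
  unfolding not_less[symmetric] by (intro polytime_intro)

lemma polytime_Suc [polytime_intro]: "polytime f \<Longrightarrow> polytime (\<lambda>x. Suc (f x))"
  unfolding Suc_eq_plus1 by (intro polytime_intro)

subsection \<open>Lists\<close>

lemma esize_Nil [simp]: "esize [] = 1"
  by (simp add: floorlog_def)

lemma esize_Cons [simp]: "esize (x # xs) = 1 + esize x + esize xs"
  by simp

lemma esize_list: "esize xs = 1 + (\<Sum>x\<leftarrow>xs. Suc (esize x))"
  by (induction xs) (simp_all del: encode_list_def)

lemma esize_pair [simp]: "esize (x, y) = 1 + esize x + esize y"
  by simp

declare encode_list_def [simp del] encode_prod_def [simp del] encode_nat_def [simp del]
  encode_bool_def [simp del]

lemma esize_append: "esize (xs @ ys) \<le> esize xs + esize ys"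
  by (simp add: esize_list)

lemma esize_rev: "esize (rev xs) = esize xs"
  by (simp add: esize_list rev_map[symmetric])

lemma esize_filter: "esize (filter P xs) \<le> esize xs"
  by (induction xs) auto

lemma esize_take: "esize (take n xs) \<le> esize xs"
  by (metis append_take_drop_id esize_list le_add1 map_append nat_add_left_cancel_le sum_list_append)

lemma esize_drop: "esize (drop n xs) \<le> esize xs"
  by (metis append_take_drop_id esize_list le_add2 map_append nat_add_left_cancel_le sum_list_append)

lemma esize_member: "x \<in> set xs \<Longrightarrow> esize x \<le> esize xs"
  by (induction xs) auto

lemma length_le_esize: "length xs \<le> esize xs"
  by (induction xs) auto

lemma esize_concat: "esize (concat xss) \<le> esize xss"
proof (induction xss)
  case (Cons xs xss)
  then show ?case using esize_append[of xs "concat xss"] by simp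
qed simp

lemma esize_list_le:
  assumes "length xs \<le> k" "\<And>x. x \<in> set xs \<Longrightarrow> esize x \<le> M"
  shows "esize xs \<le> 1 + k * Suc M"
proof -
  have "esize xs \<le> 1 + length xs * Suc M"
    using assms(2) by (induction xs) fastforce+
  also have "\<dots> \<le> 1 + k * Suc M" using mult_le_mono1[OF assms(1), of "Suc M"] by simp
  finally show ?thesis .
qed

lemma polytime_Cons [polytime_intro]:
  "polytime f \<Longrightarrow> polytime g \<Longrightarrow> polytime (\<lambda>x. f x # g x)"
  by (rule polytime_binop[of Pair_op "(#)"]) (auto simp: encode_list_def)

lemma polytime_tl [polytime_intro]:
  fixes f :: "'a::encodable \<Rightarrow> 'b::encodable list"
  assumes "polytime f" shows "polytime (\<lambda>x. tl (f x))"
proof (rule polytime_comp[OF _ assms])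
  show "polytime (\<lambda>z::'b list. tl z)"
  proof (rule polytime_expr[of "Unary Snd_op (Var 0)"])
    fix z :: "'b list"
    show "eval_expr (Unary Snd_op (Var 0)) (init_store (encode z)) = encode (tl z)"
      by (cases z) (auto simp: encode_list_def)
  next
    show "pbound (\<lambda>z::'b list. expr_time (Unary Snd_op (Var 0)) (init_store (encode z)))"
    proof (rule pbound_le[OF pbound_mult[OF pbound_const[of 2] pbound_esize]])
      fix z :: "'b list"
      show "expr_time (Unary Snd_op (Var 0)) (init_store (encode z)) \<le> 2 * esize z"
        by (cases z) (auto simp: encode_list_def)
    qed
  qed
qed

text \<open>\<open>hd []\<close> is unspecified, but it is a fixed value, which the program can contain as a literal.\<close>

lemma polytime_hd [polytime_intro]:
  fixes f :: "'a::encodable \<Rightarrow> 'b::encodable list"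
  assumes "polytime f" shows "polytime (\<lambda>x. hd (f x))"
proof (rule polytime_comp[OF _ assms])
  let ?e1 = "Unary Fst_op (Var 0)" and ?e2 = "lit (encode (hd [] :: 'b))"
  define k where "k = expr_time ?e2 (\<lambda>_. Atom 0)"
  let ?c = "If (Var 0) (Assign 0 ?e1) (Assign 0 ?e2)"
  have "runs ?c (encode z) (3 + 4 * esize z + 2 * k) (encode (hd z))" for z :: "'b list"
  proof (cases z)
    case Nil
    have *: "eval_expr (Var 0) (init_store (encode z)) = Atom 0"
      using Nil by (simp add: encode_list_def)
    have hd: "esize (hd [] :: 'b) \<le> k"
      using dsize_eval_expr[of ?e2] unfolding k_def by simp
    show ?thesis
      unfolding runs_def
      by (intro exI conjI, rule exec.IfFalse[OF * exec.Assign])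
         (use Nil hd time_lit[of "encode (hd [] :: 'b)" "init_store (encode ([] :: 'b list))" "\<lambda>_. Atom 0"] in \<open>auto simp: k_def\<close>)
  next
    case (Cons y ys)
    have *: "eval_expr (Var 0) (init_store (encode z)) \<noteq> Atom 0"
      using Cons by (simp add: encode_list_def)
    show ?thesis
      unfolding runs_def
      by (intro exI conjI, rule exec.IfTrue[OF * exec.Assign])
         (use Cons in \<open>auto simp: encode_list_def\<close>)
  qed
  moreover have "pbound (\<lambda>z::'b list. 3 + 4 * esize z + 2 * k)"
    by (intro pbound_add pbound_mult pbound_const pbound_esize)
  ultimately show "polytime (\<lambda>z::'b list. hd z)"
    unfolding polytime_def by blast
qed

text \<open>The loop state consists of the parameter \<open>x\<close>, the accumulator and the rest
  of the list. The parameter is carried along because \<open>g\<close> may depend on it, and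
  \<open>B\<close> must dominate every intermediate accumulator, not only the last.\<close>

lemma polytime_foldl:
  fixes g :: "'a::encodable \<Rightarrow> 'b::encodable \<Rightarrow> 'c::encodable \<Rightarrow> 'b"
  assumes g: "polytime (\<lambda>z. g (fst z) (fst (snd z)) (snd (snd z)))" and i: "polytime i" and l: "polytime l"
    and B: "pbound B"
    and size: "\<And>x n. n \<le> length (l x) \<Longrightarrow> esize (foldl (g x) (i x) (take n (l x))) \<le> B x"
  shows "polytime (\<lambda>x. foldl (g x) (i x) (l x))"
proof -
  define step where "step z = (fst z, g (fst z) (fst (snd z)) (hd (snd (snd z))), tl (snd (snd z)))"
    for z :: "'a \<times> 'b \<times> 'c list"
  have pow: "(step ^^ n) (x, a, ys) = (x, foldl (g x) a (take n ys), drop n ys)" if "n \<le> length ys" for x a ys n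
    using that
  proof (induction n arbitrary: a ys)
    case (Suc n)
    then obtain y ys' where "ys = y # ys'" by (cases ys) auto
    then show ?case using Suc by (simp add: funpow_swap1[symmetric] funpow_Suc_right step_def del: funpow.simps)
  qed simp
  have "polytime (\<lambda>x. (step ^^ length (l x)) (x, i x, l x))"
  proof (rule polytime_while[where b = "\<lambda>z. snd (snd z) \<noteq> []" and B = "\<lambda>x. 2 + esize x + (B x + esize (l x))"])
    show "polytime (\<lambda>z::'a \<times> 'b \<times> 'c list. snd (snd z) \<noteq> [])"
      by (intro polytime_intro)
    show "polytime step"
      unfolding step_def by (intro polytime_intro polytime_comp3[of g, OF g])
    show "pbound (\<lambda>x. length (l x))"
      by (rule pbound_le[OF polytime_esize[OF l] length_le_esize])
    show "pbound (\<lambda>x. 2 + esize x + (B x + esize (l x)))"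
      by (intro pbound_add pbound_const pbound_esize B polytime_esize[OF l])
  next
    fix x n assume "n \<le> length (l x)"
    then show "esize ((step ^^ n) (x, i x, l x)) \<le> 2 + esize x + (B x + esize (l x))"
      using size[of n x] esize_drop[of n "l x"] by (simp add: pow)
  qed (intro polytime_intro i l | simp add: pow)+
  from polytime_fst[OF polytime_snd[OF this]] show ?thesis
    by (simp add: pow)
qed

section \<open>List functions obtained from folds\<close>

lemma foldl_Cons: "foldl (\<lambda>a x. x # a) ys xs = rev xs @ ys"
  by (induction xs arbitrary: ys) auto

lemma foldl_Cons_map: "foldl (\<lambda>a x. f x # a) ys xs = rev (map f xs) @ ys"
  by (induction xs arbitrary: ys) auto

lemma polytime_rev [polytime_intro]:
  assumes "polytime f" shows "polytime (\<lambda>x. rev (f x))"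
proof -
  have "polytime (\<lambda>x. foldl (\<lambda>a y. y # a) [] (f x))"
  proof (rule polytime_foldl[where B = "\<lambda>x. esize (f x)"])
    show "esize (foldl (\<lambda>a y. y # a) [] (take n (f x))) \<le> esize (f x)" for x n
      by (simp add: foldl_Cons esize_rev esize_take)
  qed (intro polytime_intro assms polytime_esize[OF assms])+
  then show ?thesis by (simp add: foldl_Cons)
qed

lemma polytime_append [polytime_intro]:
  assumes "polytime f" "polytime g" shows "polytime (\<lambda>x. f x @ g x)"
proof -
  have "polytime (\<lambda>x. foldl (\<lambda>a y. y # a) (g x) (rev (f x)))"
  proof (rule polytime_foldl[where B = "\<lambda>x. esize (f x) + esize (g x)"])
    show "esize (foldl (\<lambda>a y. y # a) (g x) (take n (rev (f x)))) \<le> esize (f x) + esize (g x)" for x n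
    proof -
      have "esize (rev (take n (rev (f x)))) \<le> esize (f x)"
        using esize_take[of n "rev (f x)"] by (simp add: esize_rev)
      then show ?thesis
        using esize_append[of "rev (take n (rev (f x)))" "g x"] by (simp add: foldl_Cons)
    qed
  qed (intro polytime_intro assms pbound_add polytime_esize[OF assms(1)] polytime_esize[OF assms(2)])+
  then show ?thesis by (simp add: foldl_Cons)
qed

lemma polytime_map [polytime_intro]:
  fixes g :: "'a::encodable \<Rightarrow> 'b::encodable \<Rightarrow> 'c::encodable"
  assumes g: "polytime (\<lambda>z. g (fst z) (snd z))" and l: "polytime l"
  shows "polytime (\<lambda>x. map (g x) (l x))"
proof -
  obtain p where p: "\<And>z. esize (g (fst z) (snd z)) \<le> poly p (esize z)"
    using polytime_esize[OF g] unfolding pbound_def by blast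
  \<comment> \<open>Every call of \<open>g\<close> sees the parameter and one entry, a pair of size
    at most \<open>1 + esize x + esize (l x)\<close>. As no result is fed into the next call, no
    size condition remains in the statement.\<close>
  define B where "B x = 1 + esize (l x) * (1 + poly p (1 + esize x + esize (l x)))" for x
  have "polytime (\<lambda>x. foldl (\<lambda>a y. g x y # a) [] (l x))"
  proof (rule polytime_foldl[where B = B])
    show "pbound B"
      unfolding B_def by (intro pbound_add pbound_mult pbound_poly pbound_const pbound_esize polytime_esize[OF l])
    fix x n
    have "esize (map (g x) (take n (l x))) \<le> 1 + esize (l x) * Suc (poly p (1 + esize x + esize (l x)))"
    proof (rule esize_list_le)
      show "length (map (g x) (take n (l x))) \<le> esize (l x)"
        using length_le_esize[of "l x"] by simp
      fix z assume "z \<in> set (map (g x) (take n (l x)))"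
      then obtain y where y: "y \<in> set (l x)" "z = g x y" by (auto dest: in_set_takeD)
      then have "esize z \<le> poly p (esize (x, y))" using p[of "(x, y)"] by simp
      also have "\<dots> \<le> poly p (1 + esize x + esize (l x))"
        using esize_member[OF y(1)] by (intro poly_nat_mono) simp
      finally show "esize z \<le> poly p (1 + esize x + esize (l x))" .
    qed
    then show "esize (foldl (\<lambda>a y. g x y # a) [] (take n (l x))) \<le> B x"
      by (simp add: foldl_Cons_map esize_rev B_def)
  next
    show "polytime (\<lambda>z. g (fst z) (snd (snd z)) # fst (snd z))"
      by (intro polytime_intro polytime_comp2[of g, OF g])
  qed (intro polytime_intro l)+
  from polytime_rev[OF this] show ?thesis by (simp add: foldl_Cons_map)
qed

lemma foldl_append: "foldl (@) a xss = a @ concat xss"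
  by (induction xss arbitrary: a) auto

lemma polytime_concat [polytime_intro]:
  assumes "polytime f" shows "polytime (\<lambda>x. concat (f x))"
proof -
  have "polytime (\<lambda>x. foldl (@) [] (f x))"
  proof (rule polytime_foldl[where B = "\<lambda>x. esize (f x)"])
    show "esize (foldl (@) [] (take n (f x))) \<le> esize (f x)" for x n
      using order_trans[OF esize_concat esize_take] by (simp add: foldl_append)
  qed (intro polytime_intro assms polytime_esize[OF assms])+
  then show ?thesis by (simp add: foldl_append)
qed

lemma concat_map_filter: "concat (map (\<lambda>y. if P y then [y] else []) xs) = filter P xs"
  by (induction xs) auto

lemma polytime_filter [polytime_intro]:
  assumes "polytime (\<lambda>z. P (fst z) (snd z))" "polytime l"
  shows "polytime (\<lambda>x. filter (P x) (l x))"
proof (rule polytime_cong)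
  show "filter (P x) (l x) = concat (map (\<lambda>y. if P x y then [y] else []) (l x))" for x
    by (simp only: concat_map_filter)
  show "polytime (\<lambda>x. concat (map (\<lambda>y. if P x y then [y] else []) (l x)))"
    by (intro polytime_intro assms)
qed

lemma polytime_last [polytime_intro]:
  fixes f :: "'a::encodable \<Rightarrow> 'b::encodable list"
  assumes "polytime f" shows "polytime (\<lambda>x. last (f x))"
proof -
  have eq: "foldl (\<lambda>_ y. y) a xs = (if xs = [] then a else last xs)" for a :: 'b and xs
    by (induction xs arbitrary: a) auto
  have "polytime (\<lambda>x. foldl (\<lambda>_ y. y) (last [] :: 'b) (f x))"
  proof (rule polytime_foldl[where B = "\<lambda>x. esize (last [] :: 'b) + esize (f x)"])
    show "esize (foldl (\<lambda>_ y. y) (last [] :: 'b) (take n (f x))) \<le> esize (last [] :: 'b) + esize (f x)" for x n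
      using esize_member[of "last (take n (f x))" "f x"]
      using in_set_takeD[OF last_in_set, of n "f x"] by (auto simp: eq intro: trans_le_add2)
  qed (intro polytime_intro assms pbound_add pbound_const polytime_esize[OF assms])+
  then show ?thesis
    by (rule polytime_cong[rotated]) (simp add: eq)
qed

lemma polytime_member [polytime_intro]:
  assumes "polytime f" "polytime g" shows "polytime (\<lambda>x. f x \<in> set (g x))"
proof (rule polytime_cong)
  show "(f x \<in> set (g x)) = (filter (\<lambda>y. y = f x) (g x) \<noteq> [])" for x
    by (auto simp: filter_empty_conv)
  show "polytime (\<lambda>x. filter (\<lambda>y. y = f x) (g x) \<noteq> [])"
    by (intro polytime_intro assms(2) polytime_comp[OF assms(1)])
qed

text \<open>Only ranges up to the length of a list are polynomial; up to a number in binary they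
  would be exponentially long.\<close>

lemma polytime_upt_length [polytime_intro]:
  assumes "polytime f" shows "polytime (\<lambda>x. [0..<length (f x)])"
proof -
  have eq: "foldl (\<lambda>a y. a @ [Suc (last a)]) [0] xs = [0..<Suc (length xs)]" for xs :: "'b list"
    by (induction xs rule: rev_induct) auto
  have "polytime (\<lambda>x. foldl (\<lambda>a y. a @ [Suc (last a)]) [0] (f x))"
  proof (rule polytime_foldl[where B = "\<lambda>x. 1 + (1 + esize (f x)) * (3 + esize (f x))"])
    fix x n
    have "esize [0..<Suc (length (take n (f x)))] \<le> 1 + (1 + esize (f x)) * Suc (2 + esize (f x))"
    proof (rule esize_list_le)
      show "length [0..<Suc (length (take n (f x)))] \<le> 1 + esize (f x)"
        using length_le_esize[of "f x"] by simp
      fix y assume "y \<in> set [0..<Suc (length (take n (f x)))]"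
      then have "y \<le> length (f x)" by auto
      then show "esize y \<le> 2 + esize (f x)"
        using esize_le_Suc[of y] length_le_esize[of "f x"] by simp
    qed
    then show "esize (foldl (\<lambda>a y. a @ [Suc (last a)]) [0] (take n (f x))) \<le> 1 + (1 + esize (f x)) * (3 + esize (f x))"
      unfolding eq by (simp del: upt_Suc add: algebra_simps)
  qed (intro polytime_intro assms pbound_add pbound_mult pbound_const polytime_esize[OF assms])+
  then have "polytime (\<lambda>x. rev (tl (rev [0..<Suc (length (f x))])))"
    unfolding eq by (intro polytime_intro)
  then show ?thesis by simp
qed

lemma polytime_upt1_length [polytime_intro]:
  assumes "polytime f" shows "polytime (\<lambda>x. [1..<Suc (length (f x))])"
proof -
  have "polytime (\<lambda>x. map Suc [0..<length (f x)])"
    by (intro polytime_intro assms)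
  then show ?thesis by (simp add: map_Suc_upt)
qed

lemma polytime_zip [polytime_intro]:
  fixes f :: "'a::encodable \<Rightarrow> 'b::encodable list" and g :: "'a \<Rightarrow> 'c::encodable list"
  assumes "polytime f" "polytime g" shows "polytime (\<lambda>x. zip (f x) (g x))"
proof -
  define step where "step st y =
    (if snd st = [] then st else (fst st @ [(y, hd (snd st))], tl (snd st)))"
    for st :: "('b \<times> 'c) list \<times> 'c list" and y
  have eq: "foldl step (a, ys) xs = (a @ zip xs ys, drop (length xs) ys)" for a xs ys
  proof (induction xs arbitrary: a ys)
    case (Cons x xs)
    have "step (a, []) x = (a, [])" "step (a, y # ys') x = (a @ [(x, y)], ys')" for y ys'
      by (simp_all add: step_def)
    then show ?case by (cases ys) (simp_all add: Cons)
  qed simp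
  have "polytime (\<lambda>x. foldl step ([], g x) (f x))"
  proof (rule polytime_foldl[where B = "\<lambda>x. 1 + (1 + esize (f x) * (2 + esize (f x) + esize (g x))) + esize (g x)"])
    fix x n
    have "esize (zip (take n (f x)) (g x)) \<le> 1 + esize (f x) * Suc (1 + esize (f x) + esize (g x))"
    proof (rule esize_list_le)
      show "length (zip (take n (f x)) (g x)) \<le> esize (f x)"
        using length_le_esize[of "f x"] by simp
      fix z assume "z \<in> set (zip (take n (f x)) (g x))"
      then have "fst z \<in> set (f x)" "snd z \<in> set (g x)"
        by (metis in_set_takeD prod.collapse set_zip_leftD, metis prod.collapse set_zip_rightD)
      then show "esize z \<le> 1 + esize (f x) + esize (g x)"
        using esize_member[of "fst z" "f x"] esize_member[of "snd z" "g x"] esize_pair[of "fst z" "snd z"] by simp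
    qed
    then show "esize (foldl step ([], g x) (take n (f x))) \<le>
        1 + (1 + esize (f x) * (2 + esize (f x) + esize (g x))) + esize (g x)"
      using esize_drop[of "length (take n (f x))" "g x"] unfolding eq by simp
  next
    show "polytime (\<lambda>z::'a \<times> (('b \<times> 'c) list \<times> 'c list) \<times> 'b. step (fst (snd z)) (snd (snd z)))"
      unfolding step_def by (intro polytime_intro)
  qed (intro polytime_intro assms pbound_add pbound_mult pbound_const polytime_esize[OF assms(1)] polytime_esize[OF assms(2)])+
  from polytime_fst[OF this] show ?thesis by (simp add: eq)
qed

text \<open>\<open>k x\<close> is a binary number and may far exceed the length of the list, so
  entries are selected by their positions instead of counting down from \<open>k x\<close>.\<close>

lemma polytime_take [polytime_intro]:
  assumes "polytime k" "polytime l" shows "polytime (\<lambda>x. take (k x) (l x))"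
proof (rule polytime_cong)
  have "take m xs = map snd (filter (\<lambda>z. fst z < m) (zip [0..<length xs] xs))" for m and xs :: "'b list"
  proof (induction xs rule: rev_induct)
    case (snoc y xs)
    then show ?case by (auto simp: not_less)
  qed simp
  then show "take (k x) (l x) = map snd (filter (\<lambda>z. fst z < k x) (zip [0..<length (l x)] (l x)))" for x .
  show "polytime (\<lambda>x. map snd (filter (\<lambda>z. fst z < k x) (zip [0..<length (l x)] (l x))))"
    by (intro polytime_intro assms polytime_comp[OF assms(1)])
qed

lemma polytime_sum_list [polytime_intro]:
  assumes "polytime l" shows "polytime (\<lambda>x. sum_list (l x) :: nat)"
proof -
  have eq: "foldl (+) a xs = a + sum_list xs" for a :: nat and xs
    by (induction xs arbitrary: a) auto
  have size: "esize (sum_list xs) \<le> esize xs" for xs :: "nat list"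
  proof (induction xs)
    case (Cons x xs)
    then show ?case using esize_add[of x "sum_list xs"] by simp
  qed (simp add: encode_nat_def floorlog_def)
  have "polytime (\<lambda>x. foldl (+) 0 (l x))"
  proof (rule polytime_foldl[where B = "\<lambda>x. esize (l x)"])
    show "esize (foldl (+) 0 (take n (l x))) \<le> esize (l x)" for x n
      using order_trans[OF size esize_take] by (simp add: eq)
  qed (intro polytime_intro assms polytime_esize[OF assms])+
  then show ?thesis by (simp add: eq)
qed

text \<open>Bit lengths are subadditive under multiplication, so the product is about as short as
  the list; the common denominator of the weights relies on this. The extra 1 in the bound is due to
  the empty product, whose encoding has size 2.\<close>

lemma polytime_prod_list [polytime_intro]:
  assumes "polytime l" shows "polytime (\<lambda>x. prod_list (l x) :: nat)"
proof -
  have eq: "foldl (*) a xs = a * prod_list xs" for a :: nat and xs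
    by (induction xs arbitrary: a) auto
  have size: "esize (prod_list xs) \<le> 1 + esize xs" for xs :: "nat list"
  proof (induction xs)
    case (Cons x xs)
    then show ?case using esize_mult[of x "prod_list xs"] by simp
  qed (simp add: encode_nat_def floorlog_def)
  have "polytime (\<lambda>x. foldl (*) 1 (l x))"
  proof (rule polytime_foldl[where B = "\<lambda>x. 1 + esize (l x)"])
    show "esize (foldl (*) 1 (take n (l x))) \<le> 1 + esize (l x)" for x n
      using order_trans[OF size, of "take n (l x)" "1 + esize (l x)"] by (simp add: eq esize_take)
  qed (intro polytime_intro assms pbound_add pbound_const polytime_esize[OF assms])+
  then show ?thesis by (simp add: eq)
qed

text \<open>The flag of the fold stays true as long as all entries so far satisfy the
  predicate.\<close>

lemma polytime_takeWhile [polytime_intro]: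
  fixes l :: "'a::encodable \<Rightarrow> 'b::encodable list"
  assumes P: "polytime (\<lambda>z. P (fst z) (snd z))" and l: "polytime l"
  shows "polytime (\<lambda>x. takeWhile (P x) (l x))"
proof -
  define step where "step x st y = (if fst st \<and> P x y then (True, y # snd st) else (False, snd st))"
    for x and st :: "bool \<times> 'b list" and y
  have eq: "foldl (step x) (b, a) ys = (b \<and> (\<forall>y\<in>set ys. P x y), if b then rev (takeWhile (P x) ys) @ a else a)" for x a b ys
    by (induction ys arbitrary: a b) (auto simp: step_def)
  have "polytime (\<lambda>x. foldl (step x) (True, []) (l x))"
  proof (rule polytime_foldl[where B = "\<lambda>x. 3 + esize (l x)"])
    fix x n
    have "esize (takeWhile (P x) (take n (l x))) \<le> esize (l x)"
      by (metis esize_take order_trans takeWhile_eq_take)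
    then show "esize (foldl (step x) (True, []) (take n (l x))) \<le> 3 + esize (l x)"
      using esize_bool[of "\<forall>y\<in>set (take n (l x)). P x y"] by (simp add: eq esize_rev)
  next
    show "polytime (\<lambda>z. step (fst z) (fst (snd z)) (snd (snd z)))"
      unfolding step_def by (intro polytime_intro polytime_comp2[of P, OF P])
  qed (intro polytime_intro l pbound_add pbound_const polytime_esize[OF l])+
  from polytime_rev[OF polytime_snd[OF this]] show ?thesis by (simp add: eq)
qed

lemma polytime_dropWhile [polytime_intro]:
  fixes l :: "'a::encodable \<Rightarrow> 'b::encodable list"
  assumes P: "polytime (\<lambda>z. P (fst z) (snd z))" and l: "polytime l"
  shows "polytime (\<lambda>x. dropWhile (P x) (l x))"
proof -
  define step where "step x st y = (if fst st \<and> P x y then st else (False, y # snd st))"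
    for x and st :: "bool \<times> 'b list" and y
  have eq: "foldl (step x) (b, a) ys = (b \<and> (\<forall>y\<in>set ys. P x y), rev (if b then dropWhile (P x) ys else ys) @ a)" for x a b ys
    by (induction ys arbitrary: a b) (auto simp: step_def)
  have "polytime (\<lambda>x. foldl (step x) (True, []) (l x))"
  proof (rule polytime_foldl[where B = "\<lambda>x. 3 + esize (l x)"])
    fix x n
    have "esize (dropWhile (P x) (take n (l x))) \<le> esize (l x)"
      by (metis esize_drop esize_take order_trans dropWhile_eq_drop)
    then show "esize (foldl (step x) (True, []) (take n (l x))) \<le> 3 + esize (l x)"
      using esize_bool[of "\<forall>y\<in>set (take n (l x)). P x y"] by (simp add: eq esize_rev)
  next
    show "polytime (\<lambda>z. step (fst z) (fst (snd z)) (snd (snd z)))"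
      unfolding step_def by (intro polytime_intro polytime_comp2[of P, OF P])
  qed (intro polytime_intro l pbound_add pbound_const polytime_esize[OF l])+
  from polytime_rev[OF polytime_snd[OF this]] show ?thesis by (simp add: eq)
qed

section \<open>Walks in a graph with natural weights\<close>

type_synonym wedges = "(nat \<times> nat \<times> nat) list"

text \<open>Summing over all matching entries, in either orientation, avoids a partial lookup. If
  every edge is listed once, this is the weight of the one matching entry, and 0 for a
  non-edge.\<close>

definition wgt :: "wedges \<Rightarrow> nat \<Rightarrow> nat \<Rightarrow> nat" where
  "wgt es x y = (\<Sum>e\<leftarrow>es. if fst e = x \<and> fst (snd e) = y \<or> fst e = y \<and> fst (snd e) = x
     then snd (snd e) else 0)"

definition nbrs :: "wedges \<Rightarrow> nat \<Rightarrow> nat list" where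
  "nbrs es x = map (\<lambda>e. fst (snd e)) (filter (\<lambda>e. fst e = x) es) @
     map fst (filter (\<lambda>e. fst (snd e) = x) es)"

definition cost :: "wedges \<Rightarrow> nat list \<Rightarrow> nat" where
  "cost es xs = (\<Sum>z\<leftarrow>zip xs (tl xs). wgt es (fst z) (snd z))"

text \<open>Vertices may repeat: these are walks rather than simple paths.\<close>

definition path_between :: "wedges \<Rightarrow> nat \<Rightarrow> nat list \<Rightarrow> nat \<Rightarrow> bool" where
  "path_between es x p y \<longleftrightarrow>
     p \<noteq> [] \<and> successively (\<lambda>u v. v \<in> set (nbrs es u)) p \<and> hd p = x \<and> last p = y"

definition join :: "nat list \<Rightarrow> nat list \<Rightarrow> nat list" where
  "join xs ys = xs @ tl ys"

lemma wgt_commute: "wgt es x y = wgt es y x"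
  unfolding wgt_def by (induction es) auto

lemma set_nbrs: "y \<in> set (nbrs es x) \<longleftrightarrow> (\<exists>w. (x, y, w) \<in> set es \<or> (y, x, w) \<in> set es)"
  unfolding nbrs_def by force

lemma nbrs_commute: "y \<in> set (nbrs es x) \<longleftrightarrow> x \<in> set (nbrs es y)"
  unfolding set_nbrs by blast

lemma cost_Nil [simp]: "cost es [] = 0"
  and cost_single [simp]: "cost es [x] = 0"
  and cost_Cons2: "cost es (x # y # ys) = wgt es x y + cost es (y # ys)"
  by (simp_all add: cost_def)

lemma cost_append: "cost es (xs @ x # ys) = cost es (xs @ [x]) + cost es (x # ys)"
proof (induction xs rule: induct_list012)
  case (3 a b xs)
  then show ?case by (simp add: cost_Cons2)
qed (simp_all add: cost_Cons2)

lemma cost_rev: "cost es (rev xs) = cost es xs"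
proof (induction xs rule: induct_list012)
  case (3 a b xs)
  then show ?case
    using cost_append[of es "rev xs" b "[a]"] by (simp add: cost_Cons2 wgt_commute)
qed simp_all

lemma cost_join:
  assumes "xs \<noteq> []" "ys \<noteq> []" "last xs = hd ys"
  shows "cost es (join xs ys) = cost es xs + cost es ys"
proof -
  have "xs = butlast xs @ [hd ys]" "ys = hd ys # tl ys"
    using assms by (metis append_butlast_last_id, simp)
  then show ?thesis
    using cost_append[of es "butlast xs" "hd ys" "tl ys"] unfolding join_def
    by (metis append.assoc append_Cons append_Nil)
qed

lemma cost_mono_append: "cost es xs \<le> cost es (xs @ ys)"
proof (cases "xs = []")
  case False
  then have "xs @ ys = join xs (last xs # ys)" by (simp add: join_def)
  then show ?thesis using False by (simp add: cost_join)
qed simp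

lemma path_between_single [simp]: "path_between es x [x] x"
  by (simp add: path_between_def)

lemma path_between_ends:
  assumes "path_between es x p y" shows "x \<in> set p" "y \<in> set p"
  using assms hd_in_set last_in_set unfolding path_between_def by blast+

lemma path_between_join:
  assumes "path_between es x p y" "path_between es y q z"
  shows "path_between es x (join p q) z" "cost es (join p q) = cost es p + cost es q"
proof -
  have "q \<noteq> []" "hd q = y" and p: "p \<noteq> []" "last p = y"
    using assms unfolding path_between_def by auto
  then obtain q' where q: "q = y # q'" by (metis list.collapse)
  show "path_between es x (join p q) z"
    using assms unfolding path_between_def join_def q
    by (cases q') (auto simp: successively_append_iff)
  show "cost es (join p q) = cost es p + cost es q"
    using p unfolding q by (intro cost_join) auto
qed

lemma set_join:
  assumes "path_between es x p y" "path_between es y q z"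
  shows "set (join p q) = set p \<union> set q"
proof -
  have "q \<noteq> []" "hd q = y" "y \<in> set p"
    using assms unfolding path_between_def by auto
  then obtain q' where "q = y # q'" "y \<in> set p" by (metis list.collapse)
  then show ?thesis unfolding join_def by auto
qed

lemma path_between_rev:
  "path_between es x p y \<Longrightarrow> path_between es y (rev p) x"
  unfolding path_between_def
  by (auto simp: hd_rev last_rev nbrs_commute[of _ es] intro: successively_mono)

lemma path_between_append:
  "path_between es x (a @ v # b) y \<longleftrightarrow> path_between es x (a @ [v]) v \<and> path_between es v (v # b) y"
  unfolding path_between_def by (auto simp: successively_append_iff hd_append)

lemma path_between_subset:
  assumes "path_between es x p y" "x \<in> V" "\<And>u. set (nbrs es u) \<subseteq> V"
  shows "set p \<subseteq> V"
  using assms(1,2)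
proof (induction p arbitrary: x rule: induct_list012)
  case (3 a b p)
  then have "path_between es b (b # p) y" "b \<in> V"
    using assms(3)[of a] by (auto simp: path_between_def)
  then show ?case using 3 by (auto simp: path_between_def)
qed (auto simp: path_between_def)

text \<open>Cutting out the closed part between two visits of a vertex does not raise the cost,
  since weights are natural numbers. This limits the length of the walks that a search has to
  consider.\<close>

lemma path_between_distinct:
  assumes "path_between es x p y"
  shows "\<exists>q. path_between es x q y \<and> distinct q \<and> cost es q \<le> cost es p"
  using assms
proof (induction "length p" arbitrary: p rule: less_induct)
  case less
  show ?case
  proof (cases "distinct p")
    case False
    then obtain a b c v where p: "p = a @ [v] @ b @ [v] @ c"
      using not_distinct_decomp by blast
    have 1: "path_between es x (a @ [v]) v" "path_between es v (v # c) y"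
      using less.prems path_between_append[of es x a v "b @ v # c" y] path_between_append[of es v "v # b" v c y]
      unfolding p by auto
    have "path_between es x (a @ v # c) y"
      using 1 path_between_append by blast
    moreover have "cost es (a @ v # c) \<le> cost es p"
      using cost_append[of es a v c] cost_append[of es a v "b @ v # c"] cost_append[of es "v # b" v c]
      unfolding p by simp
    moreover have "length (a @ v # c) < length p" unfolding p by simp
    ultimately show ?thesis using less.hyps[of "a @ v # c"] by (meson order_trans)
  qed (use less in blast)
qed

subsection \<open>Cheapest walks from a set of vertices\<close>

text \<open>A list with at most one entry serves as an optional value, empty if there is nothing to
  choose from. Ties go to the earliest entry.\<close>

definition argmin :: "('a \<Rightarrow> nat) \<Rightarrow> 'a list \<Rightarrow> 'a list" where
  "argmin f xs = foldl (\<lambda>a y. if a = [] then [y] else if f y < f (hd a) then [y] else a) [] xs"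

lemma argmin_Nil [simp]: "argmin f [] = []"
  by (simp add: argmin_def)

lemma argmin_snoc: "argmin f (xs @ [y]) =
  (if argmin f xs = [] then [y] else if f y < f (hd (argmin f xs)) then [y] else argmin f xs)"
  by (simp add: argmin_def)

lemma argmin_cases:
  "xs = [] \<and> argmin f xs = [] \<or> (\<exists>x\<in>set xs. argmin f xs = [x] \<and> (\<forall>y\<in>set xs. f x \<le> f y))"
proof (induction xs rule: rev_induct)
  case (snoc y xs)
  then show ?case
  proof (elim disjE bexE conjE)
    fix x assume "x \<in> set xs" "argmin f xs = [x]" "\<forall>y\<in>set xs. f x \<le> f y"
    then show ?thesis by (cases "f y < f x") (auto simp: argmin_snoc intro: order_trans less_imp_le)
  qed (simp add: argmin_def)
qed simp

lemma argmin_eq_Nil [simp]: "argmin f xs = [] \<longleftrightarrow> xs = []"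
  using argmin_cases[of xs f] by auto

lemma set_argmin: "set (argmin f xs) \<subseteq> set xs"
  using argmin_cases[of xs f] by auto

lemma argmin_obtain:
  assumes "y \<in> set xs"
  obtains x where "argmin f xs = [x]" "x \<in> set xs" "f x \<le> f y"
  using argmin_cases[of xs f] assms by auto

definition extensions :: "wedges \<Rightarrow> nat list list \<Rightarrow> nat list list" where
  "extensions es C = C @ concat (map (\<lambda>p. map (\<lambda>y. p @ [y]) (nbrs es (last p))) C)"

text \<open>One walk per end vertex survives; without this the number of walks could grow
  exponentially with the rounds.\<close>

definition prune :: "wedges \<Rightarrow> nat list \<Rightarrow> nat list list \<Rightarrow> nat list list" where
  "prune es vs C = concat (map (\<lambda>v. argmin (cost es) (filter (\<lambda>p. last p = v) C)) vs)"

text \<open>Bellman and Ford's relaxation, keeping the walks instead of their lengths; the sources are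
  the members of \<open>W\<close>.\<close>

definition cheapest :: "wedges \<Rightarrow> nat list \<Rightarrow> nat list \<Rightarrow> nat list list" where
  "cheapest es vs W = foldl (\<lambda>C _. prune es vs (extensions es C)) (map (\<lambda>x. [x]) W) vs"

lemma set_prune: "set (prune es vs C) \<subseteq> set C"
  unfolding prune_def using set_argmin by fastforce

lemma set_extensions:
  "p \<in> set (extensions es C) \<longleftrightarrow> p \<in> set C \<or> (\<exists>q\<in>set C. \<exists>y\<in>set (nbrs es (last q)). p = q @ [y])"
  unfolding extensions_def by auto

text \<open>After \<open>k\<close> rounds the list is as good as the set of all walks of at most
  \<open>k\<close> edges that start in \<open>W\<close>. In the step, the walk without its last edge
  is replaced by a kept walk to the same vertex that is no more expensive, the edge is appended, and
  pruning exchanges the result only for one with the same end and no greater cost.\<close>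

lemma cheapest_invariant:
  assumes nb: "\<And>u. set (nbrs es u) \<subseteq> set vs" and W: "set W \<subseteq> set vs"
  defines "C k \<equiv> foldl (\<lambda>C _. prune es vs (extensions es C)) (map (\<lambda>x. [x]) W) (take k vs)"
  assumes "k \<le> length vs"
  shows "(\<forall>p\<in>set (C k). path_between es (hd p) p (last p) \<and> hd p \<in> set W) \<and>
    (\<forall>x q y. x \<in> set W \<and> path_between es x q y \<and> length q \<le> Suc k \<longrightarrow>
       (\<exists>p\<in>set (C k). last p = y \<and> cost es p \<le> cost es q))"
  using assms(4)
proof (induction k)
  case 0
  show ?case
  proof (intro conjI allI impI ballI)
    fix x q y assume "x \<in> set W \<and> path_between es x q y \<and> length q \<le> Suc 0"
    moreover from this have "q = [x]" by (cases q) (auto simp: path_between_def)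
    ultimately show "\<exists>p\<in>set (C 0). last p = y \<and> cost es p \<le> cost es q"
      by (auto simp: C_def path_between_def)
  qed (auto simp: C_def)
next
  case (Suc k)
  have CS: "C (Suc k) = prune es vs (extensions es (C k))"
    using Suc.prems by (simp add: C_def take_Suc_conv_app_nth)
  have sound: "path_between es (hd p) p (last p) \<and> hd p \<in> set W" if "p \<in> set (extensions es (C k))" for p
  proof (cases "p \<in> set (C k)")
    case False
    with that obtain q y where q: "q \<in> set (C k)" "y \<in> set (nbrs es (last q))" "p = q @ [y]"
      unfolding set_extensions by blast
    have "path_between es (hd q) q (last q)" "hd q \<in> set W" using q(1) Suc by auto
    then show ?thesis
      using q unfolding path_between_def by (auto simp: successively_append_iff)
  qed (use Suc in auto)
  have comp: "\<exists>p\<in>set (C k). last p = y \<and> cost es p \<le> cost es q"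
    if "x \<in> set W" "path_between es x q y" "length q \<le> Suc k" for x q y
    using that Suc by auto
  have step: "\<exists>p\<in>set (C (Suc k)). last p = last q \<and> cost es p \<le> cost es q"
    if "q \<in> set (extensions es (C k))" "last q \<in> set vs" for q
  proof -
    have "q \<in> set (filter (\<lambda>p. last p = last q) (extensions es (C k)))" using that by simp
    then obtain p where "argmin (cost es) (filter (\<lambda>p. last p = last q) (extensions es (C k))) = [p]"
      "p \<in> set (filter (\<lambda>p. last p = last q) (extensions es (C k)))" "cost es p \<le> cost es q"
      by (rule argmin_obtain)
    then show ?thesis
      using that(2) unfolding CS prune_def
      by (intro bexI[of _ p]) (auto intro!: bexI[of _ "last q"])
  qed
  show ?case
  proof (intro conjI allI impI ballI)
    fix p assume "p \<in> set (C (Suc k))"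
    then have "p \<in> set (extensions es (C k))" using CS set_prune by auto
    then show "path_between es (hd p) p (last p)" "hd p \<in> set W" using sound by auto
  next
    fix x q y assume q: "x \<in> set W \<and> path_between es x q y \<and> length q \<le> Suc (Suc k)"
    \<comment> \<open>Pruning keeps only walks that end in \<open>vs\<close>, so the end of
      \<open>q\<close> has to lie there.\<close>
    have "set q \<subseteq> set vs" using q W nb path_between_subset[of es x q y "set vs"] by blast
    then have y: "y \<in> set vs" using q by (auto simp: path_between_def)
    have "\<exists>q'\<in>set (extensions es (C k)). last q' = y \<and> cost es q' \<le> cost es q"
    proof (cases "length q \<le> Suc k")
      case True
      then show ?thesis using q comp set_extensions by blast
    next
      case False
      then obtain q0 u v where q0: "q = q0 @ [u, v]"
        using q by (cases q rule: rev_cases; cases "butlast q" rule: rev_cases) auto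
      have p0: "path_between es x (q0 @ [u]) u" "v \<in> set (nbrs es u)" "v = y"
        using q path_between_append[of es x q0 u "[v]" y] unfolding q0 by (auto simp: path_between_def)
      then obtain p where p: "p \<in> set (C k)" "last p = u" "cost es p \<le> cost es (q0 @ [u])"
        using comp[of x "q0 @ [u]" u] q q0 by auto
      have "p \<noteq> []" using p(1) Suc by (auto simp: path_between_def)
      then have "cost es (p @ [v]) = cost es p + wgt es u v"
        using cost_append[of es "butlast p" u "[v]"] p(2)
        by (metis append.assoc append_Cons append_Nil append_butlast_last_id cost_Cons2 cost_single add_0_right)
      also have "\<dots> \<le> cost es q"
        using p(3) cost_append[of es q0 u "[v]"] unfolding q0 by (simp add: cost_Cons2)
      finally show ?thesis
        using p p0 unfolding set_extensions by (intro bexI[of _ "p @ [v]"]) (auto simp: set_extensions)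
    qed
    then show "\<exists>p\<in>set (C (Suc k)). last p = y \<and> cost es p \<le> cost es q"
      using step y by (metis order_trans)
  qed
qed

lemma cheapest_sound:
  assumes "\<And>u. set (nbrs es u) \<subseteq> set vs" "set W \<subseteq> set vs" "p \<in> set (cheapest es vs W)"
  shows "path_between es (hd p) p (last p)" "hd p \<in> set W"
  using cheapest_invariant[OF assms(1,2), of "length vs"] assms(3) unfolding cheapest_def by auto

text \<open>The fold performs one round per entry of \<open>vs\<close>, and a walk without repeated
  vertices has at most that many vertices; so the restriction on the length disappears.\<close>

lemma cheapest_complete:
  assumes "\<And>u. set (nbrs es u) \<subseteq> set vs" "set W \<subseteq> set vs" "x \<in> set W" "path_between es x q y"
  shows "\<exists>p\<in>set (cheapest es vs W). last p = y \<and> cost es p \<le> cost es q"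
proof -
  obtain q' where q': "path_between es x q' y" "distinct q'" "cost es q' \<le> cost es q"
    using path_between_distinct[OF assms(4)] by blast
  have "set q' \<subseteq> set vs"
    using path_between_subset[OF q'(1), of "set vs"] assms by blast
  then have "length q' \<le> length vs"
    using q'(2) by (metis List.finite_set card_length card_mono distinct_card order_trans)
  then have "\<exists>p\<in>set (cheapest es vs W). last p = y \<and> cost es p \<le> cost es q'"
    using cheapest_invariant[OF assms(1,2), of "length vs"] q'(1) assms(3) unfolding cheapest_def by auto
  then show ?thesis using q'(3) order_trans by blast
qed

subsection \<open>Prim's algorithm\<close>

text \<open>The closed walk \<open>W\<close> is interrupted at its first visit of the start of
  \<open>p\<close> for a trip along \<open>p\<close> and back.\<close>

definition detour :: "nat list \<Rightarrow> nat list \<Rightarrow> nat list" where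
  "detour W p = join (join (join (takeWhile (\<lambda>x. x \<noteq> hd p) W @ [hd p]) p) (rev p))
     (dropWhile (\<lambda>x. x \<noteq> hd p) W)"

text \<open>The new walk may start anywhere on the current tour, also at vertices that were picked
  up only in passing. If no remaining terminal is reachable the state is kept, so rounds after the
  last terminal are harmless.\<close>

definition grow :: "wedges \<Rightarrow> nat list \<Rightarrow> nat list \<times> nat list \<Rightarrow> nat list \<times> nat list" where
  "grow es vs st = (let ps = argmin (cost es) (filter (\<lambda>p. last p \<in> set (snd st)) (cheapest es vs (fst st)))
     in if ps = [] then st else (detour (fst st) (hd ps), filter (\<lambda>x. x \<noteq> last (hd ps)) (snd st)))"

text \<open>The elements of \<open>R\<close> only count the rounds here: as long as terminals are
  left and reachable, each round removes at least one, so \<open>length R\<close> rounds are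
  enough.\<close>

definition tour :: "wedges \<Rightarrow> nat list \<Rightarrow> nat list \<Rightarrow> nat list" where
  "tour es vs R = fst (foldl (\<lambda>st _. grow es vs st) ([0], R) R)"

lemma path_between_detour:
  assumes W: "path_between es x W x" and p: "path_between es u p v" and u: "u \<in> set W"
  shows "path_between es x (detour W p) x" "cost es (detour W p) = cost es W + 2 * cost es p"
    "set (detour W p) = set W \<union> set p"
proof -
  define a b where "a = takeWhile (\<lambda>y. y \<noteq> u) W" and "b = tl (dropWhile (\<lambda>y. y \<noteq> u) W)"
  have hd: "hd p = u" using p by (simp add: path_between_def)
  have "dropWhile (\<lambda>y. y \<noteq> u) W \<noteq> []" using u by simp
  then have d: "dropWhile (\<lambda>y. y \<noteq> u) W = u # b"
    unfolding b_def by (metis (mono_tags, lifting) hd_dropWhile list.collapse)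
  have Wab: "W = a @ u # b"
    using takeWhile_dropWhile_id[of "\<lambda>y. y \<noteq> u" W] unfolding a_def d by simp
  have s: "detour W p = join (join (join (a @ [u]) p) (rev p)) (u # b)"
    unfolding detour_def hd d a_def ..
  have 1: "path_between es x (a @ [u]) u" "path_between es u (u # b) x"
    using W path_between_append unfolding Wab by blast+
  note 2 = path_between_join[OF 1(1) p]
  note 3 = path_between_join[OF 2(1) path_between_rev[OF p]]
  note 4 = path_between_join[OF 3(1) 1(2)]
  show "path_between es x (detour W p) x" using 4(1) s by simp
  show "cost es (detour W p) = cost es W + 2 * cost es p"
    unfolding s using 4(2) 3(2) 2(2) cost_append[of es a u b] by (simp add: cost_rev Wab)
  show "set (detour W p) = set W \<union> set p"
    using set_join[OF 1(1) p] set_join[OF 2(1) path_between_rev[OF p]] set_join[OF 3(1) 1(2)]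
    unfolding s by (auto simp: Wab)
qed

text \<open>The cost analysis maintains a list \<open>F\<close> of walks that start in the current tour \<open>W\<close> and
  together pass through all remaining terminals; every step of the algorithm is paid for by cutting
  off the part of some walk of \<open>F\<close> that leads to its first remaining terminal.  Initially \<open>F\<close>
  consists of the walk to be compared with.\<close>

definition tour_invariant ::
    "wedges \<Rightarrow> nat list \<Rightarrow> nat list \<Rightarrow> nat \<Rightarrow> nat \<Rightarrow> nat list \<times> nat list \<Rightarrow> bool" where
  "tour_invariant es vs R0 M K st \<longleftrightarrow>
     path_between es 0 (fst st) 0 \<and> set (fst st) \<subseteq> set vs \<and> set (snd st) \<subseteq> set R0 \<and>
     set R0 \<subseteq> set (fst st) \<union> set (snd st) \<and>
     (\<forall>x\<in>set (fst st). \<exists>q. path_between es 0 q x \<and> cost es q \<le> 2 * M) \<and>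
     (\<exists>F. (\<forall>ys\<in>set F. \<exists>x\<in>set (fst st). \<exists>y. path_between es x ys y) \<and>
        set (snd st) \<subseteq> \<Union> (set ` set F) \<and> cost es (fst st) + 2 * (\<Sum>ys\<leftarrow>F. cost es ys) \<le> K)"

text \<open>The depot lies on the tour, so the chosen walk \<open>p\<close> is no more expensive
  than the walk of cost at most \<open>M\<close> from the depot to a remaining terminal. This
  explains \<open>2 * M\<close>: a new vertex on \<open>p\<close> is reached by going to the
  terminal at the end of \<open>p\<close> and then back along \<open>p\<close>.\<close>

lemma tour_invariant_grow:
  assumes nb: "\<And>u. set (nbrs es u) \<subseteq> set vs"
    and near: "\<And>v. v \<in> set R0 \<Longrightarrow> \<exists>q. path_between es 0 q v \<and> cost es q \<le> M"
    and inv: "tour_invariant es vs R0 M K (W, R)" and "R \<noteq> []"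
  shows "tour_invariant es vs R0 M K (grow es vs (W, R))"
    "length (snd (grow es vs (W, R))) < length R"
proof -
  have W: "path_between es 0 W 0" "set W \<subseteq> set vs" "set R \<subseteq> set R0" "set R0 \<subseteq> set W \<union> set R"
    and dist: "\<And>x. x \<in> set W \<Longrightarrow> \<exists>q. path_between es 0 q x \<and> cost es q \<le> 2 * M"
    using inv unfolding tour_invariant_def by auto
  obtain F where F: "\<And>ys. ys \<in> set F \<Longrightarrow> \<exists>x\<in>set W. \<exists>y. path_between es x ys y"
    "set R \<subseteq> \<Union> (set ` set F)" "cost es W + 2 * (\<Sum>ys\<leftarrow>F. cost es ys) \<le> K"
    using inv unfolding tour_invariant_def fst_conv snd_conv by blast
  have W0: "0 \<in> set W" using path_between_ends(1)[OF W(1)] .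
  let ?C = "filter (\<lambda>p. last p \<in> set R) (cheapest es vs W)"
  have comp: "\<exists>p\<in>set ?C. cost es p \<le> cost es q" if "path_between es x q r" "x \<in> set W" "r \<in> set R" for x q r
    using cheapest_complete[OF nb W(2) that(2,1)] that(3) by auto
  obtain r where r: "r \<in> set R" using \<open>R \<noteq> []\<close> by (cases R) auto
  obtain q where q: "path_between es 0 q r" "cost es q \<le> M" using near r W(3) by blast
  have "?C \<noteq> []" using comp[OF q(1) W0 r] by (metis empty_iff empty_set)
  then obtain p where p: "argmin (cost es) ?C = [p]" "p \<in> set ?C" "\<And>p'. p' \<in> set ?C \<Longrightarrow> cost es p \<le> cost es p'"
    using argmin_cases[of ?C "cost es"] by auto
  have least: "cost es p \<le> cost es q" if "path_between es x q r" "x \<in> set W" "r \<in> set R" for x q r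
    using comp[OF that] p(3) by (meson order_trans)
  define u v where "u = hd p" and "v = last p"
  have pp: "path_between es u p v" "u \<in> set W" "v \<in> set R"
    using cheapest_sound[OF nb W(2)] p(2) unfolding u_def v_def by auto
  have pM: "cost es p \<le> M" using least[OF q(1) W0 r] q(2) by simp
  have g: "grow es vs (W, R) = (detour W p, filter (\<lambda>x. x \<noteq> v) R)"
    unfolding grow_def by (simp add: p(1) v_def)
  show "length (snd (grow es vs (W, R))) < length R"
    unfolding g using pp(3) by (simp add: length_filter_less)
  note sp = path_between_detour[OF W(1) pp(1,2)]
  have "v \<in> set p" using pp(1) by (auto simp: path_between_def)
  have "set p \<subseteq> set vs"
    using path_between_subset[OF pp(1)] pp(2) W(2) nb by blast
  have dist_p: "\<exists>q. path_between es 0 q x \<and> cost es q \<le> 2 * M" if x: "x \<in> set p" for x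
  proof -
    obtain a b where ab: "p = a @ x # b" using split_list[OF x] by blast
    have xb: "path_between es x (x # b) v" "cost es (x # b) \<le> M"
      using pp(1) pM cost_append[of es a x b] unfolding ab path_between_append[of es u a x b v] by auto
    obtain q where q: "path_between es 0 q v" "cost es q \<le> M" using near pp(3) W(3) by blast
    show ?thesis
      using path_between_join[OF q(1) path_between_rev[OF xb(1)]] q(2) xb(2)
      by (intro exI[of _ "join q (rev (x # b))"]) (simp add: cost_rev del: rev.simps)
  qed
  obtain ys where ys: "ys \<in> set F" "v \<in> set ys" using F(2) pp(3) by auto
  obtain x0 y0 where xy: "x0 \<in> set W" "path_between es x0 ys y0" using F(1) ys(1) by blast
  \<comment> \<open>The first remaining terminal \<open>r\<close> on \<open>ys\<close> may come
    before \<open>v\<close>. The part up to \<open>r\<close> starts in \<open>W\<close> and hence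
    costs at least as much as \<open>p\<close>, and no remaining terminal is lost with it except
    \<open>r\<close>, which also begins the rest.\<close>
  have "\<exists>z\<in>set ys. z \<in> set R" using ys(2) pp(3) by blast
  from split_list_first_prop[OF this]
  obtain a r b where arb: "ys = a @ r # b" "r \<in> set R" "\<forall>z\<in>set a. z \<notin> set R"
    by auto
  have ar: "path_between es x0 (a @ [r]) r" and rb: "path_between es r (r # b) y0"
    using xy(2) path_between_append[of es x0 a r b y0] unfolding arb(1) by blast+
  have "v \<in> set a \<or> v \<in> set (r # b)" using ys(2) unfolding arb(1) set_append by blast
  then have "v \<in> set (r # b)" using arb(3) pp(3) by blast
  then obtain c e where ce: "r # b = c @ v # e" using split_list by metis
  have cv: "path_between es r (c @ [v]) v" and ve: "path_between es v (v # e) y0"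
    using rb path_between_append[of es r c v e y0] unfolding ce by blast+
  obtain F1 F2 where F12: "F = F1 @ ys # F2" using split_list[OF ys(1)] by blast
  \<comment> \<open>\<open>v\<close> is now on the tour. The rest of \<open>ys\<close> is cut there
    into two walks that start at \<open>v\<close>, the first one reversed.\<close>
  define G where "G = F1 @ rev (c @ [v]) # (v # e) # F2"
  have "cost es ys = cost es (a @ [r]) + cost es (c @ [v]) + cost es (v # e)"
    using cost_append[of es a r b] cost_append[of es c v e] unfolding arb(1) ce by simp
  then have "(\<Sum>ys\<leftarrow>G. cost es ys) + cost es p \<le> (\<Sum>ys\<leftarrow>F. cost es ys)"
    using least[OF ar xy(1) arb(2)] unfolding G_def F12 by (simp add: cost_rev del: rev_append)
  then have "cost es (detour W p) + 2 * (\<Sum>ys\<leftarrow>G. cost es ys) \<le> K"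
    using F(3) sp(2) by simp
  moreover have "\<forall>ys\<in>set G. \<exists>x\<in>set (detour W p). \<exists>y. path_between es x ys y"
  proof
    fix zs assume "zs \<in> set G"
    then consider "zs = rev (c @ [v])" | "zs = v # e" | "zs \<in> set F"
      unfolding G_def F12 by auto
    then show "\<exists>x\<in>set (detour W p). \<exists>y. path_between es x zs y"
      using path_between_rev[OF cv] ve \<open>v \<in> set p\<close> F(1) unfolding sp(3) by cases blast+
  qed
  moreover have "set (filter (\<lambda>x. x \<noteq> v) R) \<subseteq> \<Union> (set ` set G)"
  proof
    fix z assume z: "z \<in> set (filter (\<lambda>x. x \<noteq> v) R)"
    then obtain zs where zs: "zs \<in> set F" "z \<in> set zs" using F(2) by auto
    show "z \<in> \<Union> (set ` set G)"
    proof (cases "zs = ys")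
      case True
      then have "z \<in> set a \<or> z \<in> set (r # b)" using zs(2) unfolding True arb(1) set_append by blast
      moreover have "z \<in> set R" using z by simp
      ultimately have "z \<in> set (c @ v # e)" using arb(3) unfolding ce by blast
      then show ?thesis unfolding G_def by auto
    next
      case False
      then show ?thesis using zs unfolding G_def F12 by auto
    qed
  qed
  ultimately have FF: "\<exists>F. (\<forall>ys\<in>set F. \<exists>x\<in>set (detour W p). \<exists>y. path_between es x ys y) \<and>
      set (filter (\<lambda>x. x \<noteq> v) R) \<subseteq> \<Union> (set ` set F) \<and> cost es (detour W p) + 2 * (\<Sum>ys\<leftarrow>F. cost es ys) \<le> K"
    by blast
  have *: "set (detour W p) \<subseteq> set vs" "set (filter (\<lambda>x. x \<noteq> v) R) \<subseteq> set R0"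
    "set R0 \<subseteq> set (detour W p) \<union> set (filter (\<lambda>x. x \<noteq> v) R)"
    using W \<open>set p \<subseteq> set vs\<close> \<open>v \<in> set p\<close> unfolding sp(3) by auto
  have **: "\<forall>x\<in>set (detour W p). \<exists>q. path_between es 0 q x \<and> cost es q \<le> 2 * M"
    unfolding sp(3) using dist dist_p by blast
  show "tour_invariant es vs R0 M K (grow es vs (W, R))"
    unfolding tour_invariant_def g fst_conv snd_conv by (intro conjI sp(1) * ** FF)
qed

lemma grow_Nil: "grow es vs (W, []) = (W, [])"
  by (simp add: grow_def)

text \<open>The factor 2 is the way there and back in each detour. The competitor \<open>q\<close>
  may end anywhere and pass through arbitrary other vertices.\<close>

lemma tour:
  assumes nb: "\<And>u. set (nbrs es u) \<subseteq> set vs" and "0 \<in> set vs"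
    and near: "\<And>v. v \<in> set R \<Longrightarrow> \<exists>q. path_between es 0 q v \<and> cost es q \<le> M"
    and q: "path_between es 0 q y" "set R \<subseteq> set q"
  shows "path_between es 0 (tour es vs R) 0" "set R \<subseteq> set (tour es vs R)"
    "cost es (tour es vs R) \<le> 2 * cost es q"
    "\<And>x. x \<in> set (tour es vs R) \<Longrightarrow> \<exists>q. path_between es 0 q x \<and> cost es q \<le> 2 * M"
    "set (tour es vs R) \<subseteq> set vs"
proof -
  let ?inv = "tour_invariant es vs R M (2 * cost es q)"
  have "?inv ([0], R)"
    unfolding tour_invariant_def fst_conv snd_conv
  proof (intro conjI ballI)
    fix x assume "x \<in> set [0::nat]"
    then show "\<exists>q. path_between es 0 q x \<and> cost es q \<le> 2 * M"
      by (intro exI[of _ "[0]"]) auto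
  next
    show "\<exists>F. (\<forall>ys\<in>set F. \<exists>x\<in>set [0]. \<exists>y. path_between es x ys y) \<and> set R \<subseteq> \<Union> (set ` set F) \<and>
      cost es [0] + 2 * (\<Sum>ys\<leftarrow>F. cost es ys) \<le> 2 * cost es q"
      using q by (intro exI[of _ "[q]"]) auto
  qed (use assms in auto)
  \<comment> \<open>Each round shortens the list of remaining terminals or finds it empty; truncated
    subtraction covers both cases.\<close>
  moreover have "?inv (foldl (\<lambda>st _. grow es vs st) st xs) \<and>
      length (snd (foldl (\<lambda>st _. grow es vs st) st xs)) \<le> length (snd st) - length xs" if "?inv st"
    for st and xs :: "nat list"
    using that
  proof (induction xs arbitrary: st)
    case (Cons x xs)
    obtain W S where st: "st = (W, S)" by (cases st)
    show ?case
    proof (cases "S = []")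
      case True
      have "foldl (\<lambda>st _. grow es vs st) (W, []) xs = (W, [])"
        by (induction xs) (auto simp: grow_Nil)
      then show ?thesis using Cons.prems unfolding st True by (simp add: grow_Nil)
    next
      case False
      have "?inv (grow es vs st)" "length (snd (grow es vs st)) < length S"
        using tour_invariant_grow[OF nb near, of R "2 * cost es q" W S] Cons.prems False unfolding st by blast+
      then show ?thesis using Cons.IH[of "grow es vs st"] unfolding st by fastforce
    qed
  qed simp
  ultimately have "?inv (foldl (\<lambda>st _. grow es vs st) ([0], R) R)"
    "length (snd (foldl (\<lambda>st _. grow es vs st) ([0], R) R)) \<le> 0"
    by (blast, metis diff_self_eq_0 snd_conv)
  then show "path_between es 0 (tour es vs R) 0" "set R \<subseteq> set (tour es vs R)"
    "cost es (tour es vs R) \<le> 2 * cost es q"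
    "\<And>x. x \<in> set (tour es vs R) \<Longrightarrow> \<exists>q. path_between es 0 q x \<and> cost es q \<le> 2 * M"
    "set (tour es vs R) \<subseteq> set vs"
    unfolding tour_def tour_invariant_def by auto
qed

subsection \<open>Splitting a tour\<close>

definition annotate :: "wedges \<Rightarrow> nat list \<Rightarrow> (nat \<times> nat) list" where
  "annotate es W = map (\<lambda>i. (cost es (take i W), last (take i W))) [1..<Suc (length W)]"

text \<open>For \<open>f = 1\<close> the range from 0 to the total cost is divided into
  \<open>p\<close> equal parts, and a position gets the number of the part that contains its prefix
  cost. Dividing by the total plus 1 keeps the number of the last position below \<open>p\<close>
  and admits tours of cost 0.\<close>

definition slot :: "wedges \<Rightarrow> nat \<Rightarrow> nat \<Rightarrow> nat list \<Rightarrow> nat \<times> nat \<Rightarrow> nat" where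
  "slot es f p W z = f * fst z * p div Suc (cost es W)"

text \<open>For \<open>f = 1\<close> (maximum cost), the tour is cut into \<open>p\<close> segments of nearly equal cost; for
  \<open>f = 0\<close> (average cost), the segment number 0 is the whole tour and the others are empty.\<close>

definition segment :: "wedges \<Rightarrow> nat \<Rightarrow> nat \<Rightarrow> nat list \<Rightarrow> nat \<Rightarrow> nat list" where
  "segment es f p W r =
     map snd (takeWhile (\<lambda>z. slot es f p W z \<le> r) (dropWhile (\<lambda>z. slot es f p W z < r) (annotate es W)))"

lemma length_annotate [simp]: "length (annotate es W) = length W"
  by (simp add: annotate_def del: upt_Suc)

lemma nth_annotate:
  "i < length W \<Longrightarrow> annotate es W ! i = (cost es (take (Suc i) W), W ! i)"
  by (simp add: annotate_def take_Suc_conv_app_nth del: upt_Suc)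

lemma map_snd_annotate: "map snd (annotate es W) = W"
  by (rule nth_equalityI) (simp_all add: nth_annotate)

lemma cost_take_mono: "i \<le> j \<Longrightarrow> cost es (take i W) \<le> cost es (take j W)"
  using cost_mono_append[of es "take i W" "take (j - i) (drop i W)"] by (metis le_add_diff_inverse take_add)

lemma sorted_slot: "sorted (map (slot es f p W) (annotate es W))"
  unfolding sorted_iff_nth_mono
  by (auto simp: nth_annotate slot_def intro!: div_le_mono mult_le_mono cost_take_mono)

text \<open>Sortedness makes the entries of one value a contiguous block, which is what
  \<open>takeWhile\<close> after \<open>dropWhile\<close> cuts out.\<close>

lemma in_takeWhile_dropWhile:
  fixes h :: "'a \<Rightarrow> nat"
  assumes "sorted (map h xs)" "z \<in> set xs"
  shows "z \<in> set (takeWhile (\<lambda>z. h z \<le> h z0) (dropWhile (\<lambda>z. h z < h z0) xs)) \<longleftrightarrow> h z = h z0"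
  using assms
proof (induction xs)
  case (Cons x xs)
  have *: "z \<in> set (takeWhile (\<lambda>z. h z \<le> h z0) ys) \<longleftrightarrow> h z \<le> h z0" if "sorted (map h ys)" "z \<in> set ys" for ys
    using that by (induction ys) auto
  show ?case
  proof (cases "h x < h z0")
    case True
    then show ?thesis using Cons by (auto dest: set_takeWhileD dest!: set_dropWhileD)
  next
    case False
    then show ?thesis using Cons.prems *[of "x # xs"] by fastforce
  qed
qed simp

text \<open>Contiguity is what makes a nonempty segment of a walk a walk again.\<close>

lemma segment_infix: "\<exists>a b. W = a @ segment es f p W r @ b"
proof -
  let ?P = "\<lambda>z. slot es f p W z < r" and ?Q = "\<lambda>z. slot es f p W z \<le> r"
  have "annotate es W = takeWhile ?P (annotate es W) @ takeWhile ?Q (dropWhile ?P (annotate es W)) @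
      dropWhile ?Q (dropWhile ?P (annotate es W))"
    by simp
  then have "map snd (annotate es W) = map snd (takeWhile ?P (annotate es W)) @ segment es f p W r @
      map snd (dropWhile ?Q (dropWhile ?P (annotate es W)))"
    unfolding segment_def by (metis map_append)
  then show ?thesis unfolding map_snd_annotate by blast
qed

lemma segment_covers:
  assumes "x \<in> set W" "f \<le> 1" "p \<ge> 1"
  shows "\<exists>r<p. x \<in> set (segment es f p W r)"
proof -
  obtain z where z: "z \<in> set (annotate es W)" "snd z = x"
    using assms(1) map_snd_annotate[of es W] by (metis (no_types, lifting) imageE list.set_map)
  then obtain i where i: "i < length W" "z = annotate es W ! i" by (metis in_set_conv_nth length_annotate)
  have "cost es (take (Suc i) W) \<le> cost es W"
    using cost_take_mono[of "Suc i" "length W" es W] i by simp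
  then have "f * fst z \<le> cost es W"
    using assms(2) i by (simp add: nth_annotate le_Suc_eq One_nat_def) (use mult_le_mono[of f 1] in fastforce)
  then have "f * fst z * p < Suc (cost es W) * p" using assms(3) by (intro mult_strict_right_mono) auto
  then have "slot es f p W z < p"
    unfolding slot_def by (simp add: less_mult_imp_div_less mult.commute)
  moreover have "x \<in> set (segment es f p W (slot es f p W z))"
    using in_takeWhile_dropWhile[OF sorted_slot z(1), where ?z0.0 = z] z(2) unfolding segment_def by force
  ultimately show ?thesis by blast
qed

text \<open>The cost of a segment is the difference of the prefix costs at its last and its first
  position. Multiplied by \<open>p\<close>, these have the same quotient by
  \<open>Suc (cost es W)\<close>, so \<open>p\<close> times their difference is at most
  \<open>cost es W\<close>. Edges between consecutive segments belong to no segment.\<close>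

lemma cost_segment: "cost es (segment es 1 p W r) * p \<le> cost es W"
proof (cases "segment es 1 p W r = []")
  case False
  let ?P = "\<lambda>z. slot es 1 p W z < r" and ?Q = "\<lambda>z. slot es 1 p W z \<le> r"
  define A where "A = annotate es W"
  define D where "D = dropWhile ?P A"
  define S where "S = takeWhile ?Q D"
  define i m where "i = length (takeWhile ?P A)" and "m = length S"
  have seg: "segment es 1 p W r = map snd S" by (simp add: segment_def S_def D_def A_def)
  then have S: "S \<noteq> []" "m > 0" using False by (auto simp: m_def)
  have D: "D = drop i A" by (simp add: D_def i_def dropWhile_eq_drop)
  have Sm: "S = take m D" by (simp add: S_def m_def takeWhile_eq_take[symmetric])
  have "m \<le> length D" unfolding m_def S_def by (rule length_takeWhile_le)
  then have im: "i + m \<le> length W" using S(2) unfolding D A_def by simp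
  have W: "segment es 1 p W r = take m (drop i W)"
    unfolding seg Sm D A_def by (simp add: map_snd_annotate flip: take_map drop_map)
  have "D \<noteq> []" using S unfolding S_def by auto
  then have lo: "r \<le> slot es 1 p W (hd D)"
    using hd_dropWhile[of ?P A] unfolding D_def by simp
  have hd: "hd D = (cost es (take (Suc i) W), W ! i)"
    using im S(2) unfolding D A_def by (simp add: hd_drop_conv_nth nth_annotate)
  have "last S \<in> set S" using S by simp
  then have hi: "slot es 1 p W (last S) \<le> r" unfolding S_def by (metis set_takeWhileD)
  have last: "last S = (cost es (take (i + m) W), W ! (i + m - 1))"
    using im S(2) \<open>m \<le> length D\<close> unfolding Sm D A_def
    by (subst last_conv_nth) (auto simp: nth_annotate min_def)
  have "drop i W = W ! i # drop (Suc i) W" using im S(2) by (simp add: Cons_nth_drop_Suc)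
  then obtain T where T: "take m (drop i W) = W ! i # T" using S(2) by (cases m) auto
  have "take (i + m) W = take i W @ W ! i # T" by (simp add: take_add T)
  moreover have "take (Suc i) W = take i W @ [W ! i]" using im S(2) by (simp add: take_Suc_conv_app_nth)
  ultimately have c: "cost es (take (i + m) W) = cost es (take (Suc i) W) + cost es (segment es 1 p W r)"
    unfolding W T using cost_append by metis
  \<comment> \<open>If \<open>b\<close> were \<open>Suc L\<close> or more, adding it to
    \<open>a\<close> would raise the quotient.\<close>
  define a b L where "a = cost es (take (Suc i) W) * p" and "b = cost es (segment es 1 p W r) * p"
    and "L = cost es W"
  have "(a + b) div Suc L \<le> a div Suc L"
    using lo hi unfolding hd last slot_def c a_def b_def L_def by (simp add: algebra_simps)
  moreover have "a div Suc L + 1 \<le> (a + b) div Suc L" if "b \<ge> Suc L"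
  proof -
    have "(a + Suc L) div Suc L = a div Suc L + 1" by (rule div_add_self2) simp
    then show ?thesis using div_le_mono[of "a + Suc L" "a + b" "Suc L"] that by (metis nat_add_left_cancel_le)
  qed
  ultimately show ?thesis unfolding b_def L_def by fastforce
qed simp

lemma slot_0 [simp]: "slot es 0 p W z = 0"
  by (simp add: slot_def)

lemma segment_0: "segment es 0 p W r = (if r = 0 then W else [])"
  by (simp add: segment_def map_snd_annotate takeWhile_eq_all_conv[THEN iffD2])

section \<open>Connecting the segments to the depot\<close>

definition access :: "wedges \<Rightarrow> nat list \<Rightarrow> nat \<Rightarrow> nat list" where
  "access es vs x = hd (argmin (cost es) (filter (\<lambda>q. last q = x) (cheapest es vs [0])))"

definition piece :: "wedges \<Rightarrow> nat list \<Rightarrow> nat \<Rightarrow> nat \<Rightarrow> nat list \<Rightarrow> nat \<Rightarrow> nat list" where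
  "piece es vs f p W k = (let S = segment es f p W (k mod p) in
     if S = [] then [0] else join (join (access es vs (hd S)) S) (rev (access es vs (last S))))"

lemma access:
  assumes nb: "\<And>u. set (nbrs es u) \<subseteq> set vs" and "0 \<in> set vs" and q: "path_between es 0 q x"
  shows "path_between es 0 (access es vs x) x" "cost es (access es vs x) \<le> cost es q"
proof -
  have W: "set [0] \<subseteq> set vs" "0 \<in> set [0::nat]" using assms(2) by auto
  obtain p where p: "p \<in> set (cheapest es vs [0])" "last p = x" "cost es p \<le> cost es q"
    using cheapest_complete[OF nb W q] by blast
  then have "p \<in> set (filter (\<lambda>q. last q = x) (cheapest es vs [0]))" by simp
  then obtain p' where p': "argmin (cost es) (filter (\<lambda>q. last q = x) (cheapest es vs [0])) = [p']"
    "p' \<in> set (filter (\<lambda>q. last q = x) (cheapest es vs [0]))" "cost es p' \<le> cost es p"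
    by (rule argmin_obtain)
  then have "access es vs x = p'" by (simp add: access_def)
  then show "path_between es 0 (access es vs x) x" "cost es (access es vs x) \<le> cost es q"
    using p' p(3) cheapest_sound[OF nb W(1), of p'] by auto
qed

lemma path_between_infix:
  assumes "path_between es x (a @ s @ b) y" "s \<noteq> []"
  shows "path_between es (hd s) s (last s)"
  using assms unfolding path_between_def by (auto simp: successively_append_iff)

lemma piece:
  assumes nb: "\<And>u. set (nbrs es u) \<subseteq> set vs" and "0 \<in> set vs"
    and W: "path_between es 0 W 0"
    and dist: "\<And>x. x \<in> set W \<Longrightarrow> \<exists>q. path_between es 0 q x \<and> cost es q \<le> M"
  shows "path_between es 0 (piece es vs f p W k) 0"
    "set (segment es f p W (k mod p)) \<subseteq> set (piece es vs f p W k)"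
    "cost es (piece es vs f p W k) \<le> cost es (segment es f p W (k mod p)) + 2 * M"
proof -
  let ?S = "segment es f p W (k mod p)"
  have "path_between es 0 (piece es vs f p W k) 0 \<and> set ?S \<subseteq> set (piece es vs f p W k) \<and>
    cost es (piece es vs f p W k) \<le> cost es ?S + 2 * M"
  proof (cases "?S = []")
    case True
    then show ?thesis by (simp add: piece_def)
  next
    case False
    obtain a b where ab: "W = a @ ?S @ b" using segment_infix by blast
    then have S: "path_between es (hd ?S) ?S (last ?S)"
      using path_between_infix[of es 0 a ?S b 0] W False by metis
    have "set ?S \<subseteq> set W" by (subst (2) ab) auto
    then have "hd ?S \<in> set W" "last ?S \<in> set W" using False hd_in_set last_in_set by blast+
    then obtain q1 q2 where q: "path_between es 0 q1 (hd ?S)" "cost es q1 \<le> M"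
      "path_between es 0 q2 (last ?S)" "cost es q2 \<le> M"
      using dist by blast
    note 1 = access[OF nb assms(2) q(1)] and 2 = access[OF nb assms(2) q(3)]
    note 3 = path_between_join[OF 1(1) S]
    note 4 = path_between_join[OF 3(1) path_between_rev[OF 2(1)]]
    have "piece es vs f p W k = join (join (access es vs (hd ?S)) ?S) (rev (access es vs (last ?S)))"
      using False by (simp add: piece_def Let_def)
    moreover have "set ?S \<subseteq> set (join (join (access es vs (hd ?S)) ?S) (rev (access es vs (last ?S))))"
      using set_join[OF 1(1) S] set_join[OF 3(1) path_between_rev[OF 2(1)]] by blast
    ultimately show ?thesis using 4 3(2) 1(2) 2(2) q by (simp add: cost_rev)
  qed
  then show "path_between es 0 (piece es vs f p W k) 0"
    "set (segment es f p W (k mod p)) \<subseteq> set (piece es vs f p W k)"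
    "cost es (piece es vs f p W k) \<le> cost es (segment es f p W (k mod p)) + 2 * M"
    by blast+
qed

lemma cost_piece_0:
  assumes nb: "\<And>u. set (nbrs es u) \<subseteq> set vs" and "0 \<in> set vs" and W: "path_between es 0 W 0"
  shows "cost es (piece es vs 0 p W k) \<le> (if p dvd k then cost es W else 0)"
proof (cases "p dvd k")
  case True
  have "W \<noteq> []" "hd W = 0" "last W = 0" using W by (auto simp: path_between_def)
  then have p: "piece es vs 0 p W k = join (join (access es vs 0) W) (rev (access es vs 0))"
    using True by (simp add: piece_def Let_def segment_0 dvd_imp_mod_0)
  \<comment> \<open>The tour starts and ends at the depot, where the trivial walk \<open>[0]\<close>
    bounds the cost of either connection by 0.\<close>
  note 1 = access[OF nb assms(2) path_between_single[of es 0]]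
  note 2 = path_between_join[OF 1(1) W]
  show ?thesis
    using path_between_join(2)[OF 2(1) path_between_rev[OF 1(1)]] 2(2) 1(2) True unfolding p
    by (simp add: cost_rev)
next
  case False
  then show ?thesis by (simp add: piece_def segment_0 dvd_eq_mod_eq_0)
qed

text \<open>Each closed walk contributes only its tail, because the one before it has already ended
  at the depot; without any walk, \<open>[0]\<close> remains.\<close>

definition chain :: "nat list list \<Rightarrow> nat list" where
  "chain ws = 0 # concat (map tl ws)"

lemma chain:
  assumes "\<And>w. w \<in> set ws \<Longrightarrow> path_between es 0 w 0"
  shows "path_between es 0 (chain ws) 0" "cost es (chain ws) = (\<Sum>w\<leftarrow>ws. cost es w)"
    "set (chain ws) = insert 0 (\<Union> (set ` set ws))"
proof -
  have "path_between es 0 (chain ws) 0 \<and> cost es (chain ws) = (\<Sum>w\<leftarrow>ws. cost es w) \<and>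
      set (chain ws) = insert 0 (\<Union> (set ` set ws))"
    using assms
  proof (induction ws)
    case (Cons w ws)
    then have IH: "path_between es 0 (chain ws) 0" "cost es (chain ws) = (\<Sum>w\<leftarrow>ws. cost es w)"
      "set (chain ws) = insert 0 (\<Union> (set ` set ws))" and w: "path_between es 0 w 0"
      by auto
    have "w \<noteq> []" "hd w = 0" using w by (auto simp: path_between_def)
    then obtain w' where "w = 0 # w'" by (metis list.collapse)
    then have "chain (w # ws) = join w (chain ws)"
      by (simp add: chain_def join_def)
    then show ?case
      using path_between_join[OF w IH(1)] set_join[OF w IH(1)] IH(2,3) path_between_ends(1)[OF w] by auto
  qed (simp add: chain_def)
  then show "path_between es 0 (chain ws) 0" "cost es (chain ws) = (\<Sum>w\<leftarrow>ws. cost es w)"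
    "set (chain ws) = insert 0 (\<Union> (set ` set ws))"
    by blast+
qed

section \<open>The algorithm runs in polynomial time\<close>

lemma polytime_wgt [polytime_intro]:
  "polytime f \<Longrightarrow> polytime g \<Longrightarrow> polytime h \<Longrightarrow> polytime (\<lambda>x. wgt (f x) (g x) (h x))"
  by (rule polytime_comp3[of wgt]) (unfold wgt_def, intro polytime_intro)

lemma polytime_nbrs [polytime_intro]:
  "polytime f \<Longrightarrow> polytime g \<Longrightarrow> polytime (\<lambda>x. nbrs (f x) (g x))"
  by (rule polytime_comp2[of nbrs]) (unfold nbrs_def, intro polytime_intro)

lemma polytime_cost [polytime_intro]:
  "polytime f \<Longrightarrow> polytime g \<Longrightarrow> polytime (\<lambda>x. cost (f x) (g x))"
  by (rule polytime_comp2[of cost]) (unfold cost_def, intro polytime_intro)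

lemma polytime_join [polytime_intro]:
  "polytime f \<Longrightarrow> polytime g \<Longrightarrow> polytime (\<lambda>x. join (f x) (g x))"
  unfolding join_def by (intro polytime_intro)

lemma polytime_argmin [polytime_intro]:
  fixes l :: "'a::encodable \<Rightarrow> 'b::encodable list"
  assumes f: "polytime (\<lambda>z. f (fst z) (snd z))" and l: "polytime l"
  shows "polytime (\<lambda>x. argmin (f x) (l x))"
  unfolding argmin_def
proof (rule polytime_foldl[where B = "\<lambda>x. 2 + esize (l x)"])
  fix x n
  let ?a = "argmin (f x) (take n (l x))"
  have "esize ?a \<le> 2 + esize (l x)"
    using argmin_cases[of "take n (l x)" "f x"] esize_member[of _ "l x"] by (auto dest!: in_set_takeD)
  then show "esize (foldl (\<lambda>a y. if a = [] then [y] else if f x y < f x (hd a) then [y] else a) []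
      (take n (l x))) \<le> 2 + esize (l x)"
    by (simp add: argmin_def)
next
  show "polytime (\<lambda>z. if fst (snd z) = [] then [snd (snd z)]
    else if f (fst z) (snd (snd z)) < f (fst z) (hd (fst (snd z))) then [snd (snd z)] else fst (snd z))"
    by (intro polytime_intro polytime_comp2[of f, OF f])
qed (intro polytime_intro l pbound_add pbound_const polytime_esize[OF l])+

lemma polytime_extensions [polytime_intro]:
  "polytime f \<Longrightarrow> polytime g \<Longrightarrow> polytime (\<lambda>x. extensions (f x) (g x))"
  by (rule polytime_comp2[of extensions]) (unfold extensions_def, intro polytime_intro)

lemma polytime_prune [polytime_intro]:
  "polytime f \<Longrightarrow> polytime g \<Longrightarrow> polytime h \<Longrightarrow> polytime (\<lambda>x. prune (f x) (g x) (h x))"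
  by (rule polytime_comp3[of prune]) (unfold prune_def, intro polytime_intro)

section \<open>Size bounds for walks and tours\<close>

lemma esize_nbrs: "y \<in> set (nbrs es x) \<Longrightarrow> esize y \<le> esize es"
  unfolding set_nbrs
proof (elim exE disjE)
  fix w assume "(x, y, w) \<in> set es"
  from esize_member[OF this] show "esize y \<le> esize es" by simp
next
  fix w assume "(y, x, w) \<in> set es"
  from esize_member[OF this] show "esize y \<le> esize es" by simp
qed

lemma length_prune: "length (prune es vs C) \<le> length vs"
proof -
  have le: "length (argmin f xs) \<le> 1" for f :: "nat list \<Rightarrow> nat" and xs
    using argmin_cases[of xs f] by auto
  show ?thesis
    unfolding prune_def
  proof (induction vs)
    case (Cons v vs)
    then show ?case
      using add_mono[OF le[of "cost es" "filter (\<lambda>p. last p = v) C"] Cons.IH] by simp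
  qed simp
qed

text \<open>Three bounds valid for arbitrary lists: pruning limits the number of walks, a round adds
  at most one vertex to a walk, and every vertex that is not a source is copied from
  \<open>es\<close>. The summand \<open>length W\<close> is for the unpruned initial list.\<close>

lemma cheapest_size:
  fixes es :: wedges and vs W :: "nat list"
  defines "C \<equiv> \<lambda>k. foldl (\<lambda>C _. prune es vs (extensions es C)) (map (\<lambda>x. [x]) W) (take k vs)"
  assumes "k \<le> length vs"
  shows "length (C k) \<le> length W + length vs \<and>
    (\<forall>p\<in>set (C k). p \<noteq> [] \<and> length p \<le> Suc k \<and> (\<forall>y\<in>set p. y \<in> set W \<or> esize y \<le> esize es))"
  using assms(2)
proof (induction k)
  case 0
  then show ?case by (auto simp: C_def)
next
  case (Suc k)
  have CS: "C (Suc k) = prune es vs (extensions es (C k))"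
    using Suc.prems by (simp add: C_def take_Suc_conv_app_nth)
  have "p \<noteq> [] \<and> length p \<le> Suc (Suc k) \<and> (\<forall>y\<in>set p. y \<in> set W \<or> esize y \<le> esize es)"
    if "p \<in> set (C (Suc k))" for p
  proof -
    have "p \<in> set (extensions es (C k))" using that set_prune unfolding CS by blast
    then consider "p \<in> set (C k)" | q y where "q \<in> set (C k)" "y \<in> set (nbrs es (last q))" "p = q @ [y]"
      unfolding set_extensions by blast
    then show ?thesis
    proof cases
      case 1
      then show ?thesis using Suc by (auto dest: Suc_leD)
    next
      case 2
      then show ?thesis using Suc esize_nbrs[OF 2(2)] by auto
    qed
  qed
  then show ?case using length_prune[of es vs "extensions es (C k)"] unfolding CS by (simp add: trans_le_add2)
qed

lemma polytime_cheapest [polytime_intro]: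
  assumes "polytime f" "polytime g" "polytime h"
  shows "polytime (\<lambda>x. cheapest (f x) (g x) (h x))"
proof (rule polytime_comp3[of cheapest, OF _ assms])
  define B where "B x = 1 + (esize (snd (snd x)) + esize (fst (snd x))) *
      Suc (1 + (1 + esize (fst (snd x))) * Suc (esize (snd (snd x)) + esize (fst x)))"
    for x :: "wedges \<times> nat list \<times> nat list"
  show "polytime (\<lambda>x. cheapest (fst x) (fst (snd x)) (snd (snd x)))"
    unfolding cheapest_def
  proof (rule polytime_foldl[where B = B])
    show "pbound B"
      unfolding B_def Suc_eq_plus1
      by (intro pbound_add pbound_mult pbound_const polytime_esize polytime_intro)
    fix x :: "wedges \<times> nat list \<times> nat list" and k
    obtain es vs W where x: "x = (es, vs, W)" by (cases x)
    assume "k \<le> length (fst (snd x))"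
    note * = cheapest_size[OF this[unfolded x, simplified], of es W]
    let ?C = "foldl (\<lambda>C _. prune es vs (extensions es C)) (map (\<lambda>x. [x]) W) (take k vs)"
    have "esize ?C \<le> 1 + (esize W + esize vs) * Suc (1 + (1 + esize vs) * Suc (esize W + esize es))"
    proof (rule esize_list_le)
      show "length ?C \<le> esize W + esize vs"
        using * length_le_esize[of W] length_le_esize[of vs] by linarith
      fix p assume p: "p \<in> set ?C"
      show "esize p \<le> 1 + (1 + esize vs) * Suc (esize W + esize es)"
      proof (rule esize_list_le)
        have "k \<le> length vs" using \<open>k \<le> length (fst (snd x))\<close> x by simp
        then show "length p \<le> 1 + esize vs"
          using * p length_le_esize[of vs] by fastforce
        show "esize y \<le> esize W + esize es" if "y \<in> set p" for y
          using * p that esize_member[of y W] by fastforce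
      qed
    qed
    then show "esize (foldl (\<lambda>C _. prune (fst x) (fst (snd x)) (extensions (fst x) C))
        (map (\<lambda>x. [x]) (snd (snd x))) (take k (fst (snd x)))) \<le> B x"
      unfolding x B_def by simp
  qed (intro polytime_intro)+
qed

lemma polytime_detour [polytime_intro]:
  "polytime f \<Longrightarrow> polytime g \<Longrightarrow> polytime (\<lambda>x. detour (f x) (g x))"
  by (rule polytime_comp2[of detour]) (unfold detour_def, intro polytime_intro)

lemma polytime_grow [polytime_intro]:
  "polytime f \<Longrightarrow> polytime g \<Longrightarrow> polytime h \<Longrightarrow> polytime (\<lambda>x. grow (f x) (g x) (h x))"
  by (rule polytime_comp3[of grow]) (unfold grow_def Let_def, intro polytime_intro)

lemma length_detour: "length (detour W p) \<le> 1 + length W + 2 * length p"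
proof -
  have "length W = length (takeWhile (\<lambda>x. x \<noteq> hd p) W) + length (dropWhile (\<lambda>x. x \<noteq> hd p) W)"
    by (metis length_append takeWhile_dropWhile_id)
  then show ?thesis by (simp add: detour_def join_def)
qed

lemma set_detour: "set (detour W p) \<subseteq> insert (hd p) (set W \<union> set p)"
proof -
  have "set (tl xs) \<subseteq> set xs" for xs :: "nat list" by (cases xs) auto
  then have "set (tl p) \<subseteq> set p" "set (tl (rev p)) \<subseteq> set p"
    "set (tl (dropWhile (\<lambda>x. x \<noteq> hd p) W)) \<subseteq> set (dropWhile (\<lambda>x. x \<noteq> hd p) W)"
    using set_rev[of p] by blast+
  moreover have "set (dropWhile (\<lambda>x. x \<noteq> hd p) W) \<subseteq> set W" "set (takeWhile (\<lambda>x. x \<noteq> hd p) W) \<subseteq> set W"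
    by (auto dest: set_takeWhileD set_dropWhileD)
  ultimately show ?thesis
    unfolding detour_def join_def set_append list.set by blast
qed

lemma in_set_cheapest:
  "p \<in> set (cheapest es vs W) \<Longrightarrow>
    p \<noteq> [] \<and> length p \<le> Suc (length vs) \<and> (\<forall>y\<in>set p. y \<in> set W \<or> esize y \<le> esize es)"
  using cheapest_size[of "length vs" vs es W] unfolding cheapest_def by simp

text \<open>A round inserts \<open>p\<close> in both directions and at most one more vertex, no more
  than \<open>2 * Suc (length vs) + 1\<close> entries. Growth is additive because the length of
  \<open>p\<close> is bounded in terms of \<open>vs\<close> and not of the tour.\<close>

lemma tour_size:
  fixes es :: wedges and vs R :: "nat list"
  defines "st \<equiv> \<lambda>k. foldl (\<lambda>st _. grow es vs st) ([0], R) (take k R)"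
  assumes "k \<le> length R"
  shows "length (fst (st k)) \<le> 1 + k * (3 + 2 * length vs) \<and>
    (\<forall>y\<in>set (fst (st k)). esize y \<le> esize es) \<and> esize (snd (st k)) \<le> esize R"
  using assms(2)
proof (induction k)
  case 0
  have "esize (0::nat) \<le> esize es" using dsize_pos[of "encode es"] by (simp add: encode_nat_def floorlog_def)
  then show ?case by (simp add: st_def)
next
  case (Suc k)
  have S: "st (Suc k) = grow es vs (st k)"
    using Suc.prems by (simp add: st_def take_Suc_conv_app_nth)
  let ?C = "filter (\<lambda>p. last p \<in> set (snd (st k))) (cheapest es vs (fst (st k)))"
  show ?case
  proof (cases "argmin (cost es) ?C = []")
    case True
    then have "st (Suc k) = st k" unfolding S grow_def by simp
    then show ?thesis using Suc by simp
  next
    case False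
    define p where "p = hd (argmin (cost es) ?C)"
    have "p \<in> set (argmin (cost es) ?C)" unfolding p_def by (rule hd_in_set[OF False])
    then have "p \<in> set ?C" by (rule subsetD[OF set_argmin])
    then have "p \<in> set (cheapest es vs (fst (st k)))" by simp
    note p = in_set_cheapest[OF this]
    have g: "st (Suc k) = (detour (fst (st k)) p, filter (\<lambda>x. x \<noteq> last p) (snd (st k)))"
      using False unfolding S grow_def p_def by (simp add: Let_def)
    have "length (detour (fst (st k)) p) \<le> 1 + Suc k * (3 + 2 * length vs)"
      using length_detour[of "fst (st k)" p] p Suc by simp
    moreover have "esize y \<le> esize es" if "y \<in> set (detour (fst (st k)) p)" for y
    proof -
      have "y \<in> set (fst (st k)) \<or> y \<in> set p"
        using subsetD[OF set_detour that] hd_in_set[of p] p by blast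
      then show ?thesis using p Suc by auto
    qed
    moreover have "esize (filter (\<lambda>x. x \<noteq> last p) (snd (st k))) \<le> esize R"
      using esize_filter[of "\<lambda>x. x \<noteq> last p" "snd (st k)"] Suc by simp
    ultimately show ?thesis unfolding g by simp
  qed
qed

lemma polytime_tour [polytime_intro]:
  assumes "polytime f" "polytime g" "polytime h"
  shows "polytime (\<lambda>x. tour (f x) (g x) (h x))"
proof (rule polytime_comp3[of tour, OF _ assms])
  define B where "B x = 1 + (1 + (1 + esize (snd (snd x)) * (3 + 2 * esize (fst (snd x)))) *
      Suc (esize (fst x))) + esize (snd (snd x))"
    for x :: "wedges \<times> nat list \<times> nat list"
  show "polytime (\<lambda>x. tour (fst x) (fst (snd x)) (snd (snd x)))"
    unfolding tour_def
  proof (rule polytime_fst, rule polytime_foldl[where B = B])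
    show "pbound B"
      unfolding B_def Suc_eq_plus1
      by (intro pbound_add pbound_mult pbound_const polytime_esize polytime_intro)
    fix x :: "wedges \<times> nat list \<times> nat list" and k
    obtain es vs R where x: "x = (es, vs, R)" by (cases x)
    assume "k \<le> length (snd (snd x))"
    then have k: "k \<le> length R" using x by simp
    note * = tour_size[OF k, of es vs]
    let ?st = "foldl (\<lambda>st _. grow es vs st) ([0], R) (take k R)"
    have "esize (fst ?st) \<le> 1 + (1 + esize R * (3 + 2 * esize vs)) * Suc (esize es)"
    proof (rule esize_list_le)
      have "k * (3 + 2 * length vs) \<le> esize R * (3 + 2 * esize vs)"
        using k length_le_esize[of R] length_le_esize[of vs] by (intro mult_le_mono) linarith+
      then show "length (fst ?st) \<le> 1 + esize R * (3 + 2 * esize vs)" using * by linarith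
    qed (use * in auto)
    moreover have "esize ?st = 1 + esize (fst ?st) + esize (snd ?st)"
      using esize_pair[of "fst ?st" "snd ?st"] by simp
    ultimately have "esize ?st \<le> B x" using * unfolding x B_def by simp
    then show "esize (foldl (\<lambda>st _. grow (fst x) (fst (snd x)) st) ([0], snd (snd x)) (take k (snd (snd x)))) \<le> B x"
      by (simp add: x)
  qed (intro polytime_intro)+
qed

lemma polytime_annotate [polytime_intro]:
  "polytime f \<Longrightarrow> polytime g \<Longrightarrow> polytime (\<lambda>x. annotate (f x) (g x))"
  by (rule polytime_comp2[of annotate]) (unfold annotate_def, intro polytime_intro)

text \<open>\<open>c\<close> is a constant, not an argument: the two objectives are served by two
  programs.\<close>

lemma polytime_segment [polytime_intro]:
  assumes "polytime f" "polytime g" "polytime h" "polytime k"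
  shows "polytime (\<lambda>x. segment (f x) c (g x) (h x) (k x))"
proof -
  have "polytime (\<lambda>z. segment (fst z) c (fst (fst (snd z))) (snd (fst (snd z))) (snd (snd z)))"
    unfolding segment_def slot_def by (intro polytime_intro)
  from polytime_comp[OF this polytime_pair[OF assms(1) polytime_pair[OF polytime_pair[OF assms(2,3)] assms(4)]]]
  show ?thesis by simp
qed

lemma polytime_access [polytime_intro]:
  "polytime f \<Longrightarrow> polytime g \<Longrightarrow> polytime h \<Longrightarrow> polytime (\<lambda>x. access (f x) (g x) (h x))"
  by (rule polytime_comp3[of access]) (unfold access_def, intro polytime_intro)

lemma polytime_piece [polytime_intro]:
  "polytime f \<Longrightarrow> polytime g \<Longrightarrow> polytime h \<Longrightarrow> polytime W \<Longrightarrow> polytime k \<Longrightarrow>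
    polytime (\<lambda>x. piece (f x) (g x) c (h x) (W x) (k x))"
  unfolding piece_def Let_def by (intro polytime_intro)

lemma polytime_chain [polytime_intro]: "polytime f \<Longrightarrow> polytime (\<lambda>x. chain (f x))"
  unfolding chain_def by (intro polytime_intro)

subsection \<open>Scaling and rounding\<close>

text \<open>An entry consists of the two ends, the numerator and the denominator. The product of the
  denominators need not be the least common one; it only has to be of polynomial length.\<close>

definition scale :: "(nat \<times> nat \<times> nat \<times> nat) list \<Rightarrow> nat" where
  "scale es = (\<Prod>e\<leftarrow>es. snd (snd (snd e)))"

definition scaled :: "(nat \<times> nat \<times> nat \<times> nat) list \<Rightarrow> wedges" where
  "scaled es = map (\<lambda>e. (fst e, fst (snd e), fst (snd (snd e)) * (scale es div snd (snd (snd e))))) es"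

text \<open>These are exactly the powers of two that are at most \<open>m\<close>, since
  \<open>floorlog 2 m\<close> is the binary length of \<open>m\<close>.\<close>

definition powers :: "nat \<Rightarrow> nat list" where
  "powers m = map (\<lambda>i. 2 ^ i) [0..<floorlog 2 m]"

definition maximum :: "nat list \<Rightarrow> nat" where
  "maximum ts = foldl (\<lambda>a t. if a < t then t else a) 0 ts"

definition terminals :: "nat list \<Rightarrow> nat \<Rightarrow> nat list" where
  "terminals ts p = map fst (filter (\<lambda>z. p \<le> snd z \<and> snd z < 2 * p) (zip [1..<Suc (length ts)] ts))"

definition vertices :: "nat list \<Rightarrow> nat list" where
  "vertices ts = 0 # [1..<Suc (length ts)]"

definition day_route :: "nat \<Rightarrow> (nat \<times> nat \<times> nat \<times> nat) list \<Rightarrow> nat list \<Rightarrow> nat \<Rightarrow> nat list" where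
  "day_route f es ts k = chain (map (\<lambda>p. piece (scaled es) (vertices ts) f p
     (tour (scaled es) (vertices ts) (terminals ts p)) k) (powers (maximum ts)))"

text \<open>The last power is a multiple of all others and thus a common period of the classes.
  Every client on the route counts as visited, whichever class led the route there.\<close>

definition day :: "nat \<Rightarrow> (nat \<times> (nat \<times> nat \<times> nat \<times> nat) list \<times> nat list) \<times> nat \<Rightarrow> nat \<times> nat list \<times> nat list" where
  "day f x = (let es = fst (snd (fst x)); ts = snd (snd (fst x)); r = day_route f es ts (snd x) in
     (last (powers (maximum ts)), r, filter (\<lambda>j. j \<in> set r) [1..<Suc (length ts)]))"

lemma polytime_scale [polytime_intro]: "polytime f \<Longrightarrow> polytime (\<lambda>x. scale (f x))"
  unfolding scale_def by (intro polytime_intro)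

lemma polytime_scaled [polytime_intro]: "polytime f \<Longrightarrow> polytime (\<lambda>x. scaled (f x))"
  by (rule polytime_comp[of scaled]) (unfold scaled_def, intro polytime_intro)

lemma polytime_maximum [polytime_intro]:
  assumes "polytime f" shows "polytime (\<lambda>x. maximum (f x))"
  unfolding maximum_def
proof (rule polytime_foldl[where B = "\<lambda>x. 1 + esize (f x)"])
  have *: "esize (foldl (\<lambda>a t. if a < t then t else a) a xs) \<le> esize a + esize xs" for a :: nat and xs
  proof (induction xs arbitrary: a)
    case (Cons x xs)
    show ?case using Cons[of a] Cons[of x] by simp
  qed simp
  have "esize (0::nat) = 1" by (simp add: encode_nat_def floorlog_def)
  then show "esize (foldl (\<lambda>a t. if a < t then t else a) 0 (take n (f x))) \<le> 1 + esize (f x)" for x n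
    using *[of 0 "take n (f x)"] esize_take[of n "f x"] by simp
qed (intro polytime_intro assms pbound_add pbound_const polytime_esize[OF assms])+

text \<open>The number of rounds is the binary length of \<open>f x\<close>, for which no list is at
  hand; hence a loop that doubles until \<open>f x\<close> is exceeded, rather than a fold.\<close>

lemma polytime_powers [polytime_intro]:
  assumes "polytime f" shows "polytime (\<lambda>x. powers (f x))"
proof -
  define g where "g z = (fst z, 2 * fst (snd z), snd (snd z) @ [fst (snd z)])"
    for z :: "nat \<times> nat \<times> nat list"
  have pow: "(g ^^ i) (m, 1, []) = (m, 2 ^ i, map (\<lambda>i. 2 ^ i) [0..<i])" for i m
    by (induction i) (simp_all add: g_def)
  have le: "2 ^ i \<le> m \<longleftrightarrow> i < floorlog 2 m" for i m :: nat
    using floorlog_le_iff[of 2 m i] by auto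
  have small: "esize (2 ^ i :: nat) \<le> 3 + esize m" if "i \<le> floorlog 2 m" for i m :: nat
  proof -
    have "floorlog 2 (2 ^ i) = Suc i"
      using floorlog_power[of 1 2 i] by (simp add: floorlog_def)
    then show ?thesis using that by (simp add: encode_nat_def)
  qed
  define B where "B x = 2 + esize (f x) + (3 + esize (f x)) + (1 + esize (f x) * Suc (3 + esize (f x)))" for x
  have "polytime (\<lambda>x. (g ^^ floorlog 2 (f x)) (f x, 1, []))"
  proof (rule polytime_while[where b = "\<lambda>z. fst (snd z) \<le> fst z" and B = B])
    show "pbound (\<lambda>x. floorlog 2 (f x))"
      by (rule pbound_le[OF polytime_esize[OF assms]]) (simp add: encode_nat_def)
    show "polytime g" unfolding g_def by (intro polytime_intro)
    show "pbound B"
      unfolding B_def Suc_eq_plus1 by (intro pbound_add pbound_mult pbound_const polytime_esize[OF assms])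
    fix x i assume i: "i \<le> floorlog 2 (f x)"
    have "esize (map (\<lambda>i. 2 ^ i :: nat) [0..<i]) \<le> 1 + esize (f x) * Suc (3 + esize (f x))"
    proof (rule esize_list_le)
      show "length (map (\<lambda>i. 2 ^ i :: nat) [0..<i]) \<le> esize (f x)" using i by (simp add: encode_nat_def)
      show "esize y \<le> 3 + esize (f x)" if "y \<in> set (map (\<lambda>i. 2 ^ i) [0..<i])" for y :: nat
        using that i small by auto
    qed
    then show "esize ((g ^^ i) (f x, 1, [])) \<le> B x"
      using small[OF i] unfolding pow B_def by simp
  next
    fix x i assume "i < floorlog 2 (f x)"
    then show "fst (snd ((g ^^ i) (f x, 1, []))) \<le> fst ((g ^^ i) (f x, 1, []))"
      unfolding pow by (simp add: le)
  next
    fix x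
    show "\<not> fst (snd ((g ^^ floorlog 2 (f x)) (f x, 1, []))) \<le> fst ((g ^^ floorlog 2 (f x)) (f x, 1, []))"
      unfolding pow using le[of "floorlog 2 (f x)" "f x"] by simp
  qed (intro polytime_intro assms)+
  from polytime_snd[OF polytime_snd[OF this]] show ?thesis
    unfolding pow powers_def by simp
qed

lemma polytime_terminals [polytime_intro]:
  "polytime f \<Longrightarrow> polytime g \<Longrightarrow> polytime (\<lambda>x. terminals (f x) (g x))"
  by (rule polytime_comp2[of terminals]) (unfold terminals_def, intro polytime_intro)

lemma polytime_vertices [polytime_intro]: "polytime f \<Longrightarrow> polytime (\<lambda>x. vertices (f x))"
  unfolding vertices_def by (intro polytime_intro)

lemma polytime_day_route [polytime_intro]:
  "polytime f \<Longrightarrow> polytime g \<Longrightarrow> polytime h \<Longrightarrow> polytime (\<lambda>x. day_route c (f x) (g x) (h x))"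
  by (rule polytime_comp3[of "day_route c"]) (unfold day_route_def, intro polytime_intro)

lemma polytime_day: "polytime (day c)"
  unfolding day_def Let_def by (intro polytime_intro)

section \<open>The schedule\<close>

text \<open>Reduces \<open>wgt\<close> to the single entry of an edge; the key will be the unordered
  pair of its ends.\<close>

lemma sum_list_distinct_key:
  assumes "distinct (map h xs)" "x \<in> set xs"
  shows "(\<Sum>y\<leftarrow>xs. if h y = h x then g y else (0::nat)) = g x"
  using assms
proof (induction xs)
  case (Cons a xs)
  show ?case
  proof (cases "a = x")
    case True
    have "(\<Sum>y\<leftarrow>xs. if h y = h x then g y else 0) = (\<Sum>y\<leftarrow>xs. 0)"
      using Cons.prems(1) True by (intro arg_cong[where f = sum_list] map_cong) (auto simp: image_iff)
    then show ?thesis using True by simp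
  next
    case False
    then have "x \<in> set xs" "h a \<noteq> h x" using Cons.prems by (auto simp: image_iff)
    then show ?thesis using Cons by simp
  qed
qed simp

lemma real_sum_list: "real (\<Sum>x\<leftarrow>xs. h x) = (\<Sum>x\<leftarrow>xs. real (h x))"
  by (induction xs) auto

lemma sum_sum_list: "(\<Sum>k\<in>A. \<Sum>x\<leftarrow>xs. h k x) = (\<Sum>x\<leftarrow>xs. \<Sum>k\<in>A. h k x :: real)"
  by (induction xs) (simp_all add: sum.distrib)

lemma maximum: "maximum ts = (if ts = [] then 0 else Max (set ts))"
proof -
  have "foldl (\<lambda>a t. if a < t then t else a) a ts = Max (insert a (set ts))" for a
  proof (induction ts arbitrary: a)
    case (Cons t ts)
    have "Max (insert a (insert t (set ts))) = Max (insert (if a < t then t else a) (set ts))"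
      by (cases "ts = []") (auto simp: max_def)
    then show ?case using Cons by simp
  qed simp
  then show ?thesis unfolding maximum_def by (cases "ts = []") (auto simp: max_def)
qed

lemma powers:
  assumes "p \<in> set (powers m)"
  shows "p \<ge> 1" "p dvd last (powers m)"
proof -
  obtain i where i: "p = 2 ^ i" "i < floorlog 2 m" using assms by (auto simp: powers_def)
  then obtain l where l: "floorlog 2 m = Suc l" by (cases "floorlog 2 m") auto
  show "p \<ge> 1" using i by simp
  show "p dvd last (powers m)" using i by (simp add: powers_def l le_imp_power_dvd)
qed

lemma last_powers_pos: "m \<ge> 1 \<Longrightarrow> last (powers m) \<ge> 1"
proof -
  assume "m \<ge> 1"
  then have "floorlog 2 m > 0" by (simp add: floorlog_def)
  then obtain l where "floorlog 2 m = Suc l" by (cases "floorlog 2 m") auto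
  then show ?thesis by (simp add: powers_def)
qed

lemma obtain_power:
  assumes "1 \<le> t" "t \<le> m"
  obtains p where "p \<in> set (powers m)" "p \<le> t" "t < 2 * p"
proof -
  have b: "2 ^ (floorlog 2 t - 1) \<le> t" "t < 2 ^ floorlog 2 t" using floorlog_bounds[of t 2] assms by auto
  have "floorlog 2 t > 0" using assms by (simp add: floorlog_def)
  then obtain l where l: "floorlog 2 t = Suc l" by (cases "floorlog 2 t") auto
  have "l < floorlog 2 m" using floorlog_mono[OF assms(2), of 2] l by simp
  then show thesis using b l by (intro that[of "2 ^ l"]) (auto simp: powers_def)
qed

text \<open>Counts the days of a period of length \<open>p * q\<close> on which, for the average
  cost, the tour of class \<open>p\<close> is made.\<close>

lemma card_multiples: "p \<ge> 1 \<Longrightarrow> card {k \<in> {1..p * q}. p dvd k} = q" for p q :: nat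
proof -
  assume p: "p \<ge> 1"
  have "{k \<in> {1..p * q}. p dvd k} = (*) p ` {1..q}"
    using p by (auto simp: dvd_def Suc_le_eq)
  moreover have "inj_on ((*) p) {1..q}" using p by (auto intro: inj_onI)
  ultimately show ?thesis by (simp add: card_image)
qed

section \<open>An instance with a listing of its edges, in integer weights\<close>

locale rftt_encoding =
  fixes I :: rftt and ends :: "(nat \<times> nat) list"
  assumes inst: "rftt_instance I"
    and distinct_ends: "distinct (map (\<lambda>(u, v). {u, v}) ends)"
    and ends: "(\<lambda>(u, v). {u, v}) ` set ends = edges I"
begin

definition es :: "(nat \<times> nat \<times> nat \<times> nat) list" where
  "es = map (\<lambda>(u, v). (u, v, map_prod nat nat (quotient_of (weight I {u, v})))) ends"

definition ts :: "nat list" where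
  "ts = map (turnover I) [1..<Suc (clients I)]"

abbreviation E :: wedges where "E \<equiv> scaled es"

abbreviation vs :: "nat list" where "vs \<equiv> vertices ts"

abbreviation D :: nat where "D \<equiv> scale es"

abbreviation pows :: "nat list" where "pows \<equiv> powers (max_turnover I)"

abbreviation T :: "nat \<Rightarrow> nat list" where "T p \<equiv> tour E vs (terminals ts p)"

lemma length_ts [simp]: "length ts = clients I"
  by (simp add: ts_def)

lemma clients_pos: "clients I \<ge> 1"
  using inst by (simp add: rftt_instance_def)

lemma turnover_pos: "j \<in> {1..clients I} \<Longrightarrow> turnover I j \<ge> 1"
  using inst by (simp add: rftt_instance_def)

lemma maximum_ts: "maximum ts = max_turnover I"
proof -
  have "ts \<noteq> []" using clients_pos length_ts by fastforce
  moreover have "set ts = turnover I ` {1..clients I}" unfolding ts_def by (auto simp del: upt_Suc)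
  ultimately show ?thesis by (simp add: maximum max_turnover_def)
qed

lemma turnover_le_max: "j \<in> {1..clients I} \<Longrightarrow> turnover I j \<le> max_turnover I"
  unfolding max_turnover_def by (intro Max_ge) auto

lemma max_turnover_pos: "max_turnover I \<ge> 1"
  using turnover_le_max[of 1] turnover_pos[of 1] clients_pos by (meson atLeastAtMost_iff order_refl order_trans)

lemma set_vs: "set vs = {0..clients I}"
  unfolding vertices_def by auto

lemma set_terminals: "set (terminals ts p) = {j \<in> {1..clients I}. p \<le> turnover I j \<and> turnover I j < 2 * p}"
proof -
  have "zip [1..<Suc (length ts)] ts = map (\<lambda>j. (j, turnover I j)) [1..<Suc (clients I)]"
    unfolding length_ts unfolding ts_def
    by (rule nth_equalityI) (simp_all del: upt_Suc)
  then show ?thesis unfolding terminals_def by (auto simp: image_iff simp del: upt_Suc)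
qed

lemma denominators:
  assumes "e \<in> set es" shows "snd (snd (snd e)) > 0" "snd (snd (snd e)) dvd D"
proof -
  have pos: "snd (snd (snd e)) > 0" if "e \<in> set es" for e
    using that quotient_of_denom_pos' unfolding es_def by (fastforce split: prod.splits)
  then show "snd (snd (snd e)) > 0" using assms by blast
  have "snd (snd (snd e)) dvd (\<Prod>e\<leftarrow>xs. snd (snd (snd e)))" if "e \<in> set xs" for xs
    using that by (induction xs) auto
  then show "snd (snd (snd e)) dvd D" using assms unfolding scale_def .
qed

lemma D_pos: "D > 0"
proof -
  have "(\<Prod>e\<leftarrow>xs. snd (snd (snd e))) > 0" if "set xs \<subseteq> set es" for xs
    using that by (induction xs) (auto simp: denominators)
  then show ?thesis unfolding scale_def by blast
qed

lemma scaled_es: "E = map (\<lambda>(u, v). (u, v, nat (fst (quotient_of (weight I {u, v}))) *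
    (D div nat (snd (quotient_of (weight I {u, v})))))) ends"
  unfolding scaled_def by (simp add: es_def split_beta)

lemma set_nbrs_E: "y \<in> set (nbrs E x) \<longleftrightarrow> {x, y} \<in> edges I"
  unfolding set_nbrs scaled_es ends[symmetric] by (force simp: doubleton_eq_iff image_iff)

lemma nbrs_vs: "set (nbrs E u) \<subseteq> set vs"
proof
  fix v assume "v \<in> set (nbrs E u)"
  then have "{u, v} \<in> edges I" by (simp add: set_nbrs_E)
  then show "v \<in> set vs" using inst unfolding rftt_instance_def set_vs by blast
qed

lemma zero_vs: "0 \<in> set vs"
  by (simp add: set_vs)

text \<open>The denominator divides \<open>D\<close>, so the integer division in
  \<open>scaled\<close> is exact; and since the weight is nonnegative, nothing is lost when its
  numerator is converted to \<open>nat\<close>.\<close>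

lemma wgt_E:
  assumes "{x, y} \<in> edges I"
  shows "real (wgt E x y) = real D * real_of_rat (weight I {x, y})"
proof -
  obtain u v where uv: "(u, v) \<in> set ends" "{u, v} = {x, y}" using assms unfolding ends[symmetric] by auto
  define h where "h = (\<lambda>e. {fst e, snd e} :: nat set)"
  define w where "w = (\<lambda>e. nat (fst (quotient_of (weight I (h e)))) * (D div nat (snd (quotient_of (weight I (h e))))))"
  have "wgt E x y = (\<Sum>e\<leftarrow>ends. if h e = h (u, v) then w e else 0)"
    unfolding wgt_def scaled_es map_map h_def w_def fst_conv snd_conv uv(2)
    by (intro arg_cong[where f = sum_list] map_cong) (auto simp: doubleton_eq_iff)
  also have "\<dots> = w (u, v)"
    using distinct_ends[unfolded case_prod_unfold] uv(1) by (intro sum_list_distinct_key) (simp_all add: h_def)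
  finally have "wgt E x y = w (u, v)" .
  moreover obtain a b where ab: "quotient_of (weight I {x, y}) = (a, b)" by fastforce
  moreover have "weight I {x, y} \<ge> 0" using inst assms by (simp add: rftt_instance_def)
  moreover have b: "b > 0" using quotient_of_denom_pos[OF ab] .
  moreover have q: "weight I {x, y} = of_int a / of_int b" using quotient_of_div[OF ab] .
  ultimately have a: "a \<ge> 0" by (simp add: zero_le_divide_iff)
  have "(u, v, nat a, nat b) \<in> set es" unfolding es_def set_map using uv ab by (intro image_eqI[of _ _ "(u, v)"]) auto
  then have "nat b dvd D" using denominators(2) by fastforce
  then have "real (D div nat b) = real D / real (nat b)" by (simp add: real_of_nat_div)
  then show ?thesis
    using \<open>wgt E x y = w (u, v)\<close> a b ab uv(2) by (simp add: w_def h_def q of_rat_divide)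
qed

lemma walk_iff_path: "u \<le> clients I \<Longrightarrow> walk I u xs v \<longleftrightarrow> path_between E u xs v"
proof
  assume "u \<le> clients I" "path_between E u xs v"
  then show "walk I u xs v"
    using path_between_subset[of E u xs v "{0..clients I}"] nbrs_vs
    unfolding walk_def path_between_def set_nbrs_E set_vs by auto
qed (auto simp: walk_def path_between_def set_nbrs_E)

lemma cost_walk:
  assumes "walk I u xs v" shows "real (cost E xs) = real D * walk_cost I xs"
proof -
  have "successively (\<lambda>x y. {x, y} \<in> edges I) xs" using assms by (simp add: walk_def)
  then show ?thesis
  proof (induction xs rule: induct_list012)
    case (3 x y xs)
    then have "real (cost E (y # xs)) = real D * walk_cost I (y # xs)" "{x, y} \<in> edges I" by auto
    then show ?case by (simp add: cost_Cons2 wgt_E walk_cost_def distrib_left)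
  qed (auto simp: walk_cost_def)
qed

lemma walk_cost_nonneg: "walk I u xs v \<Longrightarrow> walk_cost I xs \<ge> 0"
  using cost_walk[of u xs v] D_pos by (metis of_nat_0_le_iff of_nat_0_less_iff zero_le_mult_iff not_le)

text \<open>Connectivity yields some \<open>M\<close>, whose value does not matter for feasibility
  and for the average cost. A specific value is provided for the maximum cost by
  \<open>near_max_cost\<close>.\<close>

lemma near_exists: "\<exists>M. \<forall>v\<in>{0..clients I}. \<exists>q. path_between E 0 q v \<and> cost E q \<le> M"
proof -
  have "\<forall>v\<in>{0..clients I}. \<exists>q. path_between E 0 q v"
    using inst walk_iff_path[of 0] unfolding rftt_instance_def by (metis atLeastAtMost_iff le0)
  then obtain Q where Q: "\<And>v. v \<in> {0..clients I} \<Longrightarrow> path_between E 0 (Q v) v"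
    by metis
  have "cost E (Q v) \<le> Max ((\<lambda>v. cost E (Q v)) ` {0..clients I})" if "v \<in> {0..clients I}" for v
    using that by (intro Max_ge) auto
  then show ?thesis using Q by blast
qed

lemma T:
  assumes near: "\<And>v. v \<in> {1..clients I} \<Longrightarrow> \<exists>q. path_between E 0 q v \<and> cost E q \<le> M"
  shows "path_between E 0 (T p) 0" "set (terminals ts p) \<subseteq> set (T p)" "set (T p) \<subseteq> set vs"
    "\<And>x. x \<in> set (T p) \<Longrightarrow> \<exists>q. path_between E 0 q x \<and> cost E q \<le> 2 * M"
    "\<And>q y. path_between E 0 q y \<Longrightarrow> set (terminals ts p) \<subseteq> set q \<Longrightarrow> cost E (T p) \<le> 2 * cost E q"
proof -
  have near': "\<exists>q. path_between E 0 q v \<and> cost E q \<le> M" if "v \<in> set (terminals ts p)" for v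
    using that near unfolding set_terminals by blast
  then obtain Q where Q: "\<And>v. v \<in> set (terminals ts p) \<Longrightarrow> path_between E 0 (Q v) v" by metis
  \<comment> \<open>Round trips to all terminals: \<open>tour\<close> speaks about a competitor, so
    one has to exist before its other conclusions can be drawn.\<close>
  define q where "q = chain (map (\<lambda>v. join (Q v) (rev (Q v))) (terminals ts p))"
  have j: "path_between E 0 (join (Q v) (rev (Q v))) 0" "v \<in> set (join (Q v) (rev (Q v)))"
    if "v \<in> set (terminals ts p)" for v
  proof -
    note 1 = Q[OF that]
    show "path_between E 0 (join (Q v) (rev (Q v))) 0"
      using path_between_join(1)[OF 1 path_between_rev[OF 1]] .
    show "v \<in> set (join (Q v) (rev (Q v)))"
      using set_join[OF 1 path_between_rev[OF 1]] path_between_ends(2)[OF 1] by blast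
  qed
  have q: "path_between E 0 q 0" "set (terminals ts p) \<subseteq> set q"
    unfolding q_def using chain(1,3)[of "map (\<lambda>v. join (Q v) (rev (Q v))) (terminals ts p)" E] j by auto
  note * = tour[OF nbrs_vs zero_vs near']
  show "path_between E 0 (T p) 0" "set (terminals ts p) \<subseteq> set (T p)" "set (T p) \<subseteq> set vs"
    "\<And>x. x \<in> set (T p) \<Longrightarrow> \<exists>q. path_between E 0 q x \<and> cost E q \<le> 2 * M"
    using *[OF _ q] by blast+
  show "\<And>q y. path_between E 0 q y \<Longrightarrow> set (terminals ts p) \<subseteq> set q \<Longrightarrow> cost E (T p) \<le> 2 * cost E q"
    using * by blast
qed

section \<open>The schedule and its feasibility\<close>

definition sched :: "nat \<Rightarrow> schedule" where
  "sched f = \<lparr>period = last pows, route = day_route f es ts,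
     visited = (\<lambda>k. {j \<in> {1..clients I}. j \<in> set (day_route f es ts k)})\<rparr>"

lemma day_route_chain: "day_route f es ts k = chain (map (\<lambda>p. piece E vs f p (T p) k) pows)"
  unfolding day_route_def maximum_ts ..

text \<open>\<open>4 * M\<close> stands for two connections, each bounded by the distance
  \<open>2 * M\<close> of the vertices of a tour from the depot.\<close>

lemma piece_T:
  assumes "\<And>v. v \<in> {1..clients I} \<Longrightarrow> \<exists>q. path_between E 0 q v \<and> cost E q \<le> M"
  shows "path_between E 0 (piece E vs f p (T p) k) 0"
    "set (segment E f p (T p) (k mod p)) \<subseteq> set (piece E vs f p (T p) k)"
    "cost E (piece E vs f p (T p) k) \<le> cost E (segment E f p (T p) (k mod p)) + 4 * M"
  using piece[OF nbrs_vs zero_vs T(1)[OF assms] T(4)[OF assms], where f = f and p = p and k = k] by simp_all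

lemma day_route:
  "path_between E 0 (day_route f es ts k) 0"
  "cost E (day_route f es ts k) = (\<Sum>p\<leftarrow>pows. cost E (piece E vs f p (T p) k))"
  "set (day_route f es ts k) = insert 0 (\<Union>p\<in>set pows. set (piece E vs f p (T p) k))"
proof -
  obtain M where M: "\<And>v. v \<in> {1..clients I} \<Longrightarrow> \<exists>q. path_between E 0 q v \<and> cost E q \<le> M"
    using near_exists by (metis atLeastAtMost_iff le0)
  note c = chain[of "map (\<lambda>p. piece E vs f p (T p) k) pows" E]
  show "path_between E 0 (day_route f es ts k) 0"
    "cost E (day_route f es ts k) = (\<Sum>p\<leftarrow>pows. cost E (piece E vs f p (T p) k))"
    "set (day_route f es ts k) = insert 0 (\<Union>p\<in>set pows. set (piece E vs f p (T p) k))"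
    unfolding day_route_chain using c piece_T(1)[OF M, of f _ k] by (auto simp: o_def)
qed

text \<open>Segment \<open>r\<close> of class \<open>p\<close> is served on all days congruent to
  \<open>r\<close> modulo \<open>p\<close>, hence within any \<open>p\<close> consecutive days, and
  \<open>p\<close> is at most the turnover time of the client.\<close>

lemma feasible_sched:
  assumes "f \<le> 1" shows "feasible I (sched f)"
  unfolding feasible_def
proof (intro conjI allI impI ballI)
  show "period (sched f) \<ge> 1"
    using last_powers_pos[OF max_turnover_pos] by (simp add: sched_def)
  fix k :: nat
  have "piece E vs f p W (k + last pows) = piece E vs f p W k" if p: "p \<in> set pows" for p W
  proof -
    obtain q where "last pows = p * q" using powers(2)[OF p] by (elim dvdE)
    then have "(k + last pows) mod p = k mod p" by simp
    then show ?thesis by (simp only: piece_def)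
  qed
  then have "day_route f es ts (k + last pows) = day_route f es ts k"
    unfolding day_route_chain by (intro arg_cong[where f = chain] map_cong refl)
  then show "route (sched f) (k + period (sched f)) = route (sched f) k"
    "visited (sched f) (k + period (sched f)) = visited (sched f) k"
    by (simp_all add: sched_def)
  show "walk I 0 (route (sched f) k) 0"
    using day_route(1) by (simp add: sched_def walk_iff_path)
  show "visited (sched f) k \<subseteq> {1..clients I} \<inter> set (route (sched f) k)"
    by (auto simp: sched_def)
next
  fix t j assume j: "j \<in> {1..clients I}"
  obtain M where M: "\<And>v. v \<in> {1..clients I} \<Longrightarrow> \<exists>q. path_between E 0 q v \<and> cost E q \<le> M"
    using near_exists by (metis atLeastAtMost_iff le0)
  obtain p where p: "p \<in> set pows" "p \<le> turnover I j" "turnover I j < 2 * p"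
    using obtain_power[OF turnover_pos[OF j] turnover_le_max[OF j]] by blast
  have "j \<in> set (T p)" using T(2)[OF M] j p unfolding set_terminals by blast
  then obtain r where r: "r < p" "j \<in> set (segment E f p (T p) r)"
    using segment_covers[of j "T p" f p E] assms powers(1)[OF p(1)] by blast
  \<comment> \<open>The first day after \<open>t\<close> with residue \<open>r\<close>; adding
    \<open>p\<close> before subtracting keeps the truncated subtraction exact.\<close>
  define k where "k = t + 1 + (r + p - (t + 1) mod p) mod p"
  have "k mod p = r"
  proof -
    have "k mod p = ((t + 1) mod p + (r + p - (t + 1) mod p)) mod p"
      unfolding k_def by (simp only: mod_add_left_eq mod_add_right_eq)
    also have "(t + 1) mod p + (r + p - (t + 1) mod p) = r + p"
      using r(1) mod_less_divisor[of p "t + 1"] by linarith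
    finally show ?thesis using r(1) by simp
  qed
  then have "j \<in> set (day_route f es ts k)"
    using r(2) piece_T(2)[OF M, of f p k] p(1) unfolding day_route(3) by blast
  moreover have "(r + p - (t + 1) mod p) mod p < p" using r(1) by simp
  then have "k \<in> {t + 1..t + turnover I j}" using p(2) by (simp add: k_def)
  ultimately show "j \<in> (\<Union>k\<in>{t + 1..t + turnover I j}. visited (sched f) k)"
    using j by (auto simp: sched_def)
qed

lemma cost_day: "real (cost E (day_route f es ts k)) = real D * walk_cost I (route (sched f) k)"
  using cost_walk[of 0 "day_route f es ts k" 0] day_route(1) by (simp add: sched_def walk_iff_path)

text \<open>In every window of \<open>2 * p\<close> days, each client of turnover time less than \<open>2 * p\<close> is
  visited, so that the routes of these days form a competitor for the tour.\<close>

lemma cost_T_window: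
  assumes S: "feasible I S"
  shows "real (cost E (T p)) \<le> 2 * (real D * (\<Sum>k = t..<t + 2 * p. walk_cost I (route S (Suc k))))"
proof -
  obtain M where M: "\<And>v. v \<in> {1..clients I} \<Longrightarrow> \<exists>q. path_between E 0 q v \<and> cost E q \<le> M"
    using near_exists by (metis atLeastAtMost_iff le0)
  have w: "walk I 0 (route S (Suc k)) 0" for k using S by (simp add: feasible_def)
  \<comment> \<open>With \<open>Suc k\<close> for \<open>k\<close> the days run from
    \<open>t + 1\<close> to \<open>t + 2 * p\<close>, which includes \<open>t + 1\<close> to
    \<open>t + turnover I j\<close> for every terminal \<open>j\<close>.\<close>
  define ws where "ws = map (\<lambda>k. route S (Suc k)) [t..<t + 2 * p]"
  have ws: "path_between E 0 w 0" if "w \<in> set ws" for w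
    using that w walk_iff_path[of 0] unfolding ws_def by auto
  have "set (terminals ts p) \<subseteq> set (chain ws)"
  proof
    fix j assume j: "j \<in> set (terminals ts p)"
    then have "j \<in> {1..clients I}" and tj: "turnover I j < 2 * p" unfolding set_terminals by auto
    then have "j \<in> (\<Union>k\<in>{t + 1..t + turnover I j}. visited S k)" using S unfolding feasible_def by blast
    then obtain k where k: "k \<in> {t + 1..t + turnover I j}" "j \<in> visited S k" by blast
    moreover from this have "k \<ge> 1" by simp
    ultimately have "j \<in> set (route S k)" using S unfolding feasible_def by blast
    moreover have "k = Suc (k - 1)" "k - 1 \<in> set [t..<t + 2 * p]" using k(1) tj by auto
    then have "route S k \<in> set ws" unfolding ws_def by force
    ultimately show "j \<in> set (chain ws)" using chain(3)[of ws E] ws by blast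
  qed
  then have "cost E (T p) \<le> 2 * cost E (chain ws)" using T(5)[OF M] chain(1)[OF ws] by blast
  moreover have "real (cost E (chain ws)) = (\<Sum>k = t..<t + 2 * p. real D * walk_cost I (route S (Suc k)))"
  proof -
    have "cost E (chain ws) = (\<Sum>w\<leftarrow>ws. cost E w)" using ws by (rule chain(2))
    then have "real (cost E (chain ws)) = (\<Sum>w\<leftarrow>ws. real (cost E w))" by (simp only: real_sum_list)
    also have "\<dots> = (\<Sum>k\<leftarrow>[t..<t + 2 * p]. real D * walk_cost I (route S (Suc k)))"
      unfolding ws_def map_map by (simp add: o_def cost_walk[OF w])
    finally show ?thesis by (simp add: interv_sum_list_conv_sum_set_nat)
  qed
  ultimately have "real (cost E (T p)) \<le> 2 * (\<Sum>k = t..<t + 2 * p. real D * walk_cost I (route S (Suc k)))"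
    by linarith
  then show ?thesis by (simp only: sum_distrib_left)
qed

lemma length_pows [simp]: "length pows = floorlog 2 (max_turnover I)"
  by (simp add: powers_def)

lemma walk_cost_le_max_cost:
  assumes S: "feasible I S" and "k \<ge> 1"
  shows "walk_cost I (route S k) \<le> max_cost I S"
proof -
  have per: "route S (k + m * period S) = route S k" if "k \<ge> 1" for m k
  proof (induction m)
    case (Suc m)
    have "route S (k + m * period S + period S) = route S (k + m * period S)"
      using S that unfolding feasible_def by simp
    then show ?case using Suc by (simp add: algebra_simps)
  qed simp
  have pos: "period S \<ge> 1" using S by (simp add: feasible_def)
  \<comment> \<open>The day between 1 and \<open>period S\<close> that is congruent to
    \<open>k\<close>; the shift by 1 is there because days are numbered from 1.\<close>
  let ?k = "Suc ((k - 1) mod period S)"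
  have "k = ?k + (k - 1) div period S * period S" using assms(2) by simp
  then have "route S k = route S ?k" using per[of ?k] by (metis Suc_le_mono One_nat_def le0)
  moreover have "?k \<in> {1..period S}" using pos by (simp add: Suc_le_eq)
  ultimately show ?thesis unfolding max_cost_def by (intro Max_ge) auto
qed

text \<open>A route through \<open>v\<close> splits there into a walk to \<open>v\<close> and a walk
  back, and the cheaper of the two costs at most half. The bound is rounded down since costs in
  \<open>E\<close> are natural numbers.\<close>

lemma near_max_cost:
  assumes S: "feasible I S" and v: "v \<in> {1..clients I}"
  shows "\<exists>q. path_between E 0 q v \<and> cost E q \<le> nat \<lfloor>real D * max_cost I S / 2\<rfloor>"
proof -
  have "v \<in> (\<Union>k\<in>{0 + 1..0 + turnover I v}. visited S k)" using S v unfolding feasible_def by blast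
  then obtain k where k: "k \<ge> 1" "v \<in> visited S k" by auto
  then have "v \<in> set (route S k)" using S unfolding feasible_def by blast
  then obtain a b where ab: "route S k = a @ v # b" by (metis split_list)
  have w: "walk I 0 (route S k) 0" using S k unfolding feasible_def by blast
  then have p: "path_between E 0 (a @ [v]) v" "path_between E v (v # b) 0"
    unfolding ab walk_iff_path[OF le0] using path_between_append by blast+
  have "real (cost E (a @ [v])) + real (cost E (v # b)) = real D * walk_cost I (route S k)"
    using cost_walk[OF w] unfolding ab cost_append[of E a v b] by simp
  also have "\<dots> \<le> real D * max_cost I S"
    using walk_cost_le_max_cost[OF S k(1)] by (intro mult_left_mono) auto
  finally have "real (cost E (a @ [v])) \<le> real D * max_cost I S / 2 \<or>
      real (cost E (rev (v # b))) \<le> real D * max_cost I S / 2"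
    unfolding cost_rev by linarith
  then show ?thesis
    using p(1) path_between_rev[OF p(2)] by (auto simp: le_nat_floor)
qed

text \<open>With \<open>B\<close> the scaled cost of \<open>S\<close>, the tour of class
  \<open>p\<close> costs at most \<open>4 * B * real p\<close> and a segment at most
  \<open>4 * B\<close>. The connections add \<open>4 * M\<close>, which is at most
  \<open>2 * B\<close> because \<open>M\<close> is at most half of \<open>B\<close>.\<close>

lemma max_cost_sched:
  assumes S: "feasible I S"
  shows "max_cost I (sched 1) \<le> 6 * real (floorlog 2 (max_turnover I)) * max_cost I S"
proof -
  define B where "B = real D * max_cost I S"
  define M where "M = nat \<lfloor>B / 2\<rfloor>"
  have near: "\<exists>q. path_between E 0 q v \<and> cost E q \<le> M" if "v \<in> {1..clients I}" for v
    using near_max_cost[OF S that] unfolding M_def B_def .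
  have "walk I 0 (route S 1) 0" using S by (simp add: feasible_def)
  then have "max_cost I S \<ge> 0" using walk_cost_nonneg walk_cost_le_max_cost[OF S, of 1] by fastforce
  then have B: "B \<ge> 0" by (simp add: B_def)
  then have BM: "real M \<le> B / 2" unfolding M_def by (intro of_nat_floor) simp
  have piece: "real (cost E (piece E vs 1 p (T p) k)) \<le> 6 * B" if p: "p \<in> set pows" for p k
  proof -
    let ?c = "cost E (segment E 1 p (T p) (k mod p))"
    have "real ?c * real p = real (?c * p)" by simp
    also have "\<dots> \<le> real (cost E (T p))" using cost_segment of_nat_le_iff by blast
    also have "\<dots> \<le> 2 * (real D * (\<Sum>k = 0..<0 + 2 * p. walk_cost I (route S (Suc k))))"
      by (rule cost_T_window[OF S])
    also have "\<dots> \<le> 2 * (real D * (\<Sum>k = 0..<0 + 2 * p. max_cost I S))"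
      by (intro mult_left_mono sum_mono walk_cost_le_max_cost[OF S]) auto
    also have "\<dots> = 4 * B * real p" by (simp add: B_def)
    finally have "real ?c \<le> 4 * B" using powers(1)[OF p] by simp
    moreover have "real (cost E (piece E vs 1 p (T p) k)) \<le> real ?c + 4 * real M"
      using piece_T(3)[OF near, of 1 p k] by (metis (mono_tags) of_nat_add of_nat_le_iff of_nat_mult of_nat_numeral)
    ultimately show ?thesis using BM by linarith
  qed
  have "walk_cost I (route (sched 1) k) \<le> 6 * real (floorlog 2 (max_turnover I)) * max_cost I S" for k
  proof -
    have "real D * walk_cost I (route (sched 1) k) = (\<Sum>p\<leftarrow>pows. real (cost E (piece E vs 1 p (T p) k)))"
      unfolding cost_day[symmetric] day_route(2) real_sum_list ..
    also have "\<dots> \<le> (\<Sum>p\<leftarrow>pows. 6 * B)"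
      by (rule sum_list_mono) (rule piece)
    also have "\<dots> = real D * (6 * real (floorlog 2 (max_turnover I)) * max_cost I S)"
      by (simp add: sum_list_triv B_def)
    finally show ?thesis using D_pos by simp
  qed
  moreover have "period (sched 1) \<ge> 1" using feasible_sched[of 1] by (simp add: feasible_def)
  ultimately show ?thesis unfolding max_cost_def[of I "sched 1"] by (subst Max_le_iff) auto
qed

text \<open>A single window of \<open>2 * p\<close> days may be far more expensive than the average
  suggests. So the window bound is summed over \<open>period S\<close> consecutive windows, which
  together fill exactly \<open>2 * p\<close> periods.\<close>

lemma cost_T_avg:
  assumes S: "feasible I S"
  shows "real (cost E (T p)) \<le> 4 * real p * (real D * avg_cost I S)"
proof -
  define g where "g k = walk_cost I (route S (Suc k))" for k
  define l where "l = period S"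
  have l: "l \<ge> 1" using S by (simp add: feasible_def l_def)
  have "\<forall>k\<ge>1. route S (k + l) = route S k" using S unfolding feasible_def l_def by blast
  then have "g (k + l) = g k" for k unfolding g_def by (metis add_Suc le_add1 plus_1_eq_Suc)
  then have per: "g (m * l + k) = g k" for m k
    by (induction m) (simp_all add: add.commute add.left_commute, metis add.commute add.left_commute)
  \<comment> \<open>The same \<open>2 * p * l\<close> days are grouped twice: here into
    \<open>2 * p\<close> periods, further down into \<open>l\<close> windows.\<close>
  have "(\<Sum>k<2 * p * l. g k) = (\<Sum>m<2 * p. sum g {m * l..<m * l + l})"
    by (rule sum.nat_group[symmetric])
  also have "\<dots> = (\<Sum>m<2 * p. sum g {..<l})"
  proof (rule sum.cong)
    fix m
    have "sum g {m * l..<m * l + l} = (\<Sum>k<l. g (m * l + k))"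
      using sum.shift_bounds_nat_ivl[of g 0 "m * l" l] by (simp add: atLeast0LessThan add.commute)
    then show "sum g {m * l..<m * l + l} = sum g {..<l}" by (simp add: per)
  qed simp
  also have "\<dots> = 2 * real p * sum g {..<l}" by simp
  also have "sum g {..<l} = real l * avg_cost I S"
    using l unfolding avg_cost_def g_def l_def by (simp add: sum.atLeast1_atMost_eq)
  finally have total: "(\<Sum>k<2 * p * l. g k) = 2 * real p * (real l * avg_cost I S)" .
  have "real l * real (cost E (T p)) = (\<Sum>m<l. real (cost E (T p)))" by simp
  also have "\<dots> \<le> (\<Sum>m<l. 2 * (real D * sum g {m * (2 * p)..<m * (2 * p) + 2 * p}))"
    unfolding g_def by (intro sum_mono cost_T_window[OF S])
  also have "\<dots> = 2 * (real D * (\<Sum>m<l. sum g {m * (2 * p)..<m * (2 * p) + 2 * p}))"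
    by (simp add: sum_distrib_left)
  also have "(\<Sum>m<l. sum g {m * (2 * p)..<m * (2 * p) + 2 * p}) = (\<Sum>k<2 * p * l. g k)"
    by (subst sum.nat_group) (simp add: mult.commute)
  finally have "real l * real (cost E (T p)) \<le> real l * (4 * real p * (real D * avg_cost I S))"
    unfolding total by (simp add: algebra_simps)
  then show ?thesis using l by simp
qed

text \<open>In a period of \<open>P = p * q\<close> days the tour of class \<open>p\<close> is made
  \<open>q\<close> times, at a cost of at most \<open>4 * real p * B\<close> each; so the class
  contributes at most \<open>4 * B\<close> per day.\<close>

lemma avg_cost_sched:
  assumes S: "feasible I S"
  shows "avg_cost I (sched 0) \<le> 6 * real (floorlog 2 (max_turnover I)) * avg_cost I S"
proof -
  obtain M where M: "\<And>v. v \<in> {1..clients I} \<Longrightarrow> \<exists>q. path_between E 0 q v \<and> cost E q \<le> M"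
    using near_exists by (metis atLeastAtMost_iff le0)
  define P where "P = last pows"
  have P: "P \<ge> 1" unfolding P_def by (rule last_powers_pos[OF max_turnover_pos])
  define B where "B = real D * avg_cost I S"
  have "walk I 0 (route S k) 0" if "k \<ge> 1" for k using S that by (simp add: feasible_def)
  then have "avg_cost I S \<ge> 0"
    unfolding avg_cost_def by (intro divide_nonneg_nonneg sum_nonneg walk_cost_nonneg) auto
  then have B: "B \<ge> 0" by (simp add: B_def)
  have piece: "(\<Sum>k = 1..P. real (cost E (piece E vs 0 p (T p) k))) \<le> 4 * B * real P" if p: "p \<in> set pows" for p
  proof -
    obtain q where q: "P = p * q" using powers(2)[OF p] unfolding P_def by (auto elim: dvdE)
    have "(\<Sum>k = 1..P. real (cost E (piece E vs 0 p (T p) k)))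
        \<le> (\<Sum>k = 1..P. if p dvd k then real (cost E (T p)) else 0)"
    proof (rule sum_mono)
      fix k
      show "real (cost E (piece E vs 0 p (T p) k)) \<le> (if p dvd k then real (cost E (T p)) else 0)"
        using cost_piece_0[OF nbrs_vs zero_vs T(1)[OF M], of p p k] by (simp split: if_splits)
    qed
    also have "\<dots> = real (cost E (T p)) * real q"
      using card_multiples[OF powers(1)[OF p], of q] by (simp add: sum.If_cases q Int_def)
    also have "\<dots> \<le> 4 * real p * B * real q"
      using cost_T_avg[OF S, of p] unfolding B_def by (intro mult_right_mono) auto
    also have "\<dots> = 4 * B * real P" by (simp add: q)
    finally show ?thesis .
  qed
  have "real D * (\<Sum>k = 1..P. walk_cost I (route (sched 0) k)) =
      (\<Sum>k = 1..P. \<Sum>p\<leftarrow>pows. real (cost E (piece E vs 0 p (T p) k)))"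
    unfolding sum_distrib_left cost_day[symmetric] day_route(2) real_sum_list ..
  also have "\<dots> = (\<Sum>p\<leftarrow>pows. \<Sum>k = 1..P. real (cost E (piece E vs 0 p (T p) k)))"
    by (rule sum_sum_list)
  also have "\<dots> \<le> (\<Sum>p\<leftarrow>pows. 4 * B * real P)"
    by (rule sum_list_mono) (rule piece)
  \<comment> \<open>The constant 4 is enlarged to 6 here, so that both objectives share one
    ratio.\<close>
  also have "\<dots> \<le> real D * (6 * real (floorlog 2 (max_turnover I)) * avg_cost I S * real P)"
    using \<open>avg_cost I S \<ge> 0\<close> by (simp add: sum_list_triv B_def mult_right_mono)
  finally have "(\<Sum>k = 1..P. walk_cost I (route (sched 0) k)) \<le>
      6 * real (floorlog 2 (max_turnover I)) * avg_cost I S * real P"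
    using D_pos by simp
  then show ?thesis
    using P unfolding avg_cost_def[of I "sched 0"] by (simp add: sched_def P_def divide_le_eq)
qed

text \<open>\<open>opt\<close> is an infimum, so the comparison with each feasible schedule is
  divided by \<open>a\<close> to give a lower bound of the whole set.\<close>

lemma le_opt:
  assumes "\<And>S. feasible I S \<Longrightarrow> obj I (sched f) \<le> a * obj I S" "f \<le> 1" "a > 0"
  shows "obj I (sched f) \<le> a * opt obj I"
proof -
  have "obj I (sched f) / a \<le> Inf {obj I S | S. feasible I S}"
  proof (rule cInf_greatest)
    show "{obj I S | S. feasible I S} \<noteq> {}" using feasible_sched[OF assms(2)] by blast
    fix x assume "x \<in> {obj I S | S. feasible I S}"
    then show "obj I (sched f) / a \<le> x" using assms(1,3) by (auto simp: divide_le_eq mult.commute)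
  qed
  then show ?thesis using assms(3) by (simp add: opt_def divide_le_eq mult.commute)
qed

section \<open>From the schedule to the program\<close>

lemma encodes_day_sched:
  "encodes_day (encode (day f ((clients I, es, ts), k))) (sched f) k"
proof -
  let ?js = "filter (\<lambda>j. j \<in> set (day_route f es ts k)) [1..<Suc (clients I)]"
  have "distinct ?js" "set ?js = visited (sched f) k"
    by (auto simp: sched_def simp del: upt_Suc)
  then show ?thesis
    unfolding encodes_day_def
    by (intro exI[of _ ?js])
       (simp add: day_def Let_def maximum_ts sched_def encode_prod_def encode_list_def encode_nat_def del: upt_Suc)
qed

lemma encoding:
  "Node (Atom (clients I))
     (Node (enc_list (\<lambda>(u, v). Node (Atom u) (Node (Atom v) (enc_rat (weight I {u, v})))) ends)
       (enc_list (\<lambda>j. Atom (turnover I j)) [1..<Suc (clients I)])) = encode (clients I, es, ts)"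
proof -
  have "enc_list (\<lambda>(u, v). Node (Atom u) (Node (Atom v) (enc_rat (weight I {u, v})))) xs =
      encode (map (\<lambda>(u, v). (u, v, map_prod nat nat (quotient_of (weight I {u, v})))) xs)" for xs
    by (induction xs)
       (auto simp: enc_rat_def encode_list_def encode_prod_def encode_nat_def split: prod.splits)
  moreover have "enc_list (\<lambda>j. Atom (turnover I j)) xs = encode (map (turnover I) xs)" for xs
    by (induction xs) (auto simp: encode_list_def encode_nat_def)
  ultimately show ?thesis
    by (simp add: es_def ts_def encode_prod_def encode_nat_def del: upt_Suc)
qed

end

text \<open>The polynomial comes from the program alone and so precedes the choice of the instance.
  The schedule depends on the listing of the edges found in the input, but not on the day.\<close>

lemma poly_time_approximation_day:
  assumes "f \<le> 1"
    and cost: "\<And>I ends S. rftt_encoding I ends \<Longrightarrow> feasible I S \<Longrightarrow>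
      obj I (rftt_encoding.sched I ends f) \<le> 6 * real (floorlog 2 (max_turnover I)) * obj I S"
  shows "\<exists>c. poly_time_approximation obj (\<lambda>I. 6 * real (floorlog 2 (max_turnover I))) c"
proof -
  obtain c T where "pbound T" and run: "\<And>x. runs c (encode x) (T x) (encode (day f x))"
    using polytime_day unfolding polytime_def by blast
  then obtain p where p: "\<And>x. T x \<le> poly p (esize x)" unfolding pbound_def by blast
  have "poly_time_approximation obj (\<lambda>I. 6 * real (floorlog 2 (max_turnover I))) c"
    unfolding poly_time_approximation_def
  proof (rule exI[of _ p], intro allI impI, elim conjE)
    fix I d assume I: "rftt_instance I" and "encodes_instance d I"
    then obtain ends where ends: "distinct (map (\<lambda>(u, v). {u, v}) ends)" "(\<lambda>(u, v). {u, v}) ` set ends = edges I"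
      and d: "d = Node (Atom (clients I))
         (Node (enc_list (\<lambda>(u, v). Node (Atom u) (Node (Atom v) (enc_rat (weight I {u, v})))) ends)
               (enc_list (\<lambda>j. Atom (turnover I j)) [1..<Suc (clients I)]))"
      unfolding encodes_instance_def by blast
    interpret rftt_encoding I ends
      by standard (use I ends in auto)
    have pos: "6 * real (floorlog 2 (max_turnover I)) > 0"
      using max_turnover_pos floorlog_eq_zero_iff[of 2 "max_turnover I"] by auto
    have day: "\<exists>r. encodes_day r (sched f) k \<and>
        computes_within c (Node d (Atom k)) (poly p (dsize (Node d (Atom k)))) r" for k
    proof (intro exI conjI)
      let ?x = "((clients I, es, ts), k)"
      have x: "Node d (Atom k) = encode ?x"
        unfolding d encoding by (simp add: encode_prod_def encode_nat_def)
      show "encodes_day (encode (day f ?x)) (sched f) k" by (rule encodes_day_sched)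
      show "computes_within c (Node d (Atom k)) (poly p (dsize (Node d (Atom k)))) (encode (day f ?x))"
      proof -
        obtain t s where "exec c (init_store (encode ?x)) t s" "t + esize (day f ?x) \<le> T ?x"
          "s 0 = encode (day f ?x)"
          using run[of ?x] unfolding runs_def by blast
        moreover have "t \<le> poly p (esize ?x)" using calculation(2) p[of ?x] by linarith
        ultimately show ?thesis unfolding computes_within_def x by blast
      qed
    qed
    show "\<exists>S. feasible I S \<and> obj I S \<le> 6 * real (floorlog 2 (max_turnover I)) * opt obj I \<and>
        (\<forall>k\<ge>1. \<exists>r. encodes_day r S k \<and> computes_within c (Node d (Atom k)) (poly p (dsize (Node d (Atom k)))) r)"
      by (intro exI[of _ "sched f"] conjI allI impI feasible_sched assms(1) le_opt pos day
          cost[OF rftt_encoding_axioms])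
  qed
  then show ?thesis ..
qed

text \<open>For \<open>m \<ge> 2\<close> the binary length exceeds \<open>log 2 (real m)\<close> by
  at most 1, and that logarithm is at least 1; this turns 6 into 12. At \<open>m = 1\<close> the
  logarithm vanishes while the ratio does not, so the bound starts at 2.\<close>

lemma floorlog_bigo_ln: "(\<lambda>m. 6 * real (floorlog 2 m)) \<in> O(\<lambda>m. ln (real m))"
proof (rule bigoI[where c = "12 / ln 2"], rule eventually_sequentiallyI[of 2])
  fix m :: nat assume m: "m \<ge> 2"
  have "log 2 (real m) \<ge> 1" using m by (simp add: le_log_iff)
  moreover have "real (floorlog 2 m) \<le> log 2 (real m) + 1"
    using m calculation by (simp add: floorlog_def)
  ultimately have "6 * real (floorlog 2 m) \<le> 12 * log 2 (real m)" by linarith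
  then show "norm (6 * real (floorlog 2 m)) \<le> 12 / ln 2 * norm (ln (real m))"
    using m by (simp add: log_def)
qed

theorem theorem6:
  "(\<exists>\<alpha> :: nat \<Rightarrow> real. \<alpha> \<in> O(\<lambda>m. ln (real m)) \<and>
      (\<exists>c. poly_time_approximation max_cost (\<lambda>I. \<alpha> (max_turnover I)) c)) \<and>
   (\<exists>\<alpha> :: nat \<Rightarrow> real. \<alpha> \<in> O(\<lambda>m. ln (real m)) \<and>
      (\<exists>c. poly_time_approximation avg_cost (\<lambda>I. \<alpha> (max_turnover I)) c))"
proof -
  have max: "\<exists>c. poly_time_approximation max_cost (\<lambda>I. 6 * real (floorlog 2 (max_turnover I))) c"
    using rftt_encoding.max_cost_sched by (intro poly_time_approximation_day[of 1]) simp_all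
  have avg: "\<exists>c. poly_time_approximation avg_cost (\<lambda>I. 6 * real (floorlog 2 (max_turnover I))) c"
    using rftt_encoding.avg_cost_sched by (intro poly_time_approximation_day[of 0]) simp_all
  show ?thesis
    by (rule conjI; rule exI[of _ "\<lambda>m. 6 * real (floorlog 2 m)"]; rule conjI[OF floorlog_bigo_ln])
       (rule max avg)+
qed

end
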